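(* Let $\Sigma_{\mathcal C}=(M,K,Fe)$ be a Cartan mechanical system. The following properties hold: 1. $\xi$ given in local coordinates by $$\xi=\frac12\left[\frac{\partial K^2}{\partial p_i}\frac{\partial}{\partial x^i}-\left(\frac{\partial K^2}{\partial x^i}-F_i\right)\frac{\partial}{\partial p_i}\right]$$ is a (globally defined) vector field on $\widetilde{T^*M}$. 2. $\xi$ is determined only by the Cartan mechanical system $\Sigma_{\mathcal C}$. 3. The integral curves of $\xi$ are given by the evolution equations of $\Sigma_{\mathcal C}$: $$\frac{dx^i}{dt}-\frac12\frac{\partial K^2}{\partial p_i}=0,\qquad \frac{dp_i}{dt}+\frac12\frac{\partial K^2}{\partial x^i}=\frac12F_i(x,p).$$
   Context: The summation convention is used. $M$ is a real $n$-dimensional smooth manifold, $T^*M$ its cotangent bundle with induced local coordinates $(x^i,p_i)$, and $\widetilde{T^*M}$ is $T^*M$ with the zero section removed. A Cartan space $\mathcal C^n=(M,K)$ is given by a function $K:T^*M\to\mathbb R$, smooth on $\widetilde{T^*M}$ and continuous on the zero section, positive, positively 1-homogeneous in the momenta $p_i$, such that $g^{ij}=\frac12\frac{\partial^2K^2}{\partial p_i\partial p_j}$ is positive definite on $\widetilde{T^*M}$. A Cartan mechanical system is a triple $\Sigma_{\mathcal C}=(M,K,Fe)$ where $(M,K)$ is a Cartan space and $Fe=F_i(x,p)\frac{\partial}{\partial p_i}$ is a given vertical vector field on $T^*M$ (external forces). *)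

theory Defs
  imports "HOL-Analysis.Analysis"
begin

subsection \<open>Smooth maps between Euclidean spaces\<close>

text \<open>These two notions are meant for open sets \<open>S\<close> in finite-dimensional spaces. The directional
  derivatives of all orders up to \<open>k\<close> are required to exist and to be continuous.\<close>

primrec C_diff_on ::
  "nat \<Rightarrow> 'a::real_normed_vector set \<Rightarrow> ('a \<Rightarrow> 'b::real_normed_vector) \<Rightarrow> bool" where
  "C_diff_on 0 S f \<longleftrightarrow> continuous_on S f"
| "C_diff_on (Suc k) S f \<longleftrightarrow>
     (\<forall>x\<in>S. f differentiable (at x)) \<and>
     (\<forall>v. C_diff_on k S (\<lambda>x. frechet_derivative f (at x) v))"

definition smooth_on ::
  "'a::real_normed_vector set \<Rightarrow> ('a \<Rightarrow> 'b::real_normed_vector) \<Rightarrow> bool" where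
  "smooth_on S f \<longleftrightarrow> (\<forall>k. C_diff_on k S f)"


subsection \<open>Smooth manifolds\<close>

text \<open>A chart is a total function that only matters on its domain. The points of a manifold are those
  covered by its charts, and its topology is the one induced by the charts.\<close>

type_synonym ('a, 'e) chart = "'a set \<times> ('a \<Rightarrow> 'e)"

abbreviation chart_dom :: "('a, 'e) chart \<Rightarrow> 'a set" where
  "chart_dom c \<equiv> fst c"

abbreviation chart_map :: "('a, 'e) chart \<Rightarrow> 'a \<Rightarrow> 'e" where
  "chart_map c \<equiv> snd c"

definition chart_inv :: "('a, 'e) chart \<Rightarrow> 'e \<Rightarrow> 'a" where
  "chart_inv c = inv_into (chart_dom c) (chart_map c)"

definition manifold_carrier :: "('a, 'e) chart set \<Rightarrow> 'a set" where
  "manifold_carrier A = (\<Union>c\<in>A. chart_dom c)"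

definition manifold_topology :: "('a, 'e::euclidean_space) chart set \<Rightarrow> 'a topology" where
  "manifold_topology A =
     topology_generated_by {chart_dom c \<inter> chart_map c -` W | c W. c \<in> A \<and> open W}"

definition smooth_atlas :: "('a, 'e::euclidean_space) chart set \<Rightarrow> bool" where
  "smooth_atlas A \<longleftrightarrow>
     (\<forall>c\<in>A. inj_on (chart_map c) (chart_dom c) \<and> open (chart_map c ` chart_dom c)) \<and>
     (\<forall>c\<in>A. \<forall>d\<in>A. open (chart_map c ` (chart_dom c \<inter> chart_dom d)) \<and>
        smooth_on (chart_map c ` (chart_dom c \<inter> chart_dom d)) (\<lambda>y. chart_map d (chart_inv c y)))"

text \<open>The atlas of a smooth manifold is maximal, so it consists of all local coordinate systems. Its
  dimension is that of the model space \<open>'e\<close>.\<close>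

definition smooth_manifold :: "('a, 'e::euclidean_space) chart set \<Rightarrow> bool" where
  "smooth_manifold A \<longleftrightarrow>
     smooth_atlas A \<and>
     (\<forall>c. chart_dom c \<subseteq> manifold_carrier A \<and> smooth_atlas (insert c A) \<longrightarrow> c \<in> A) \<and>
     Hausdorff_space (manifold_topology A) \<and>
     second_countable (manifold_topology A)"

definition smooth_fun_on ::
  "('a, 'e::euclidean_space) chart set \<Rightarrow> 'a set \<Rightarrow> ('a \<Rightarrow> real) \<Rightarrow> bool" where
  "smooth_fun_on A W f \<longleftrightarrow>
     (\<forall>c\<in>A. smooth_on (chart_map c ` (chart_dom c \<inter> W)) (\<lambda>y. f (chart_inv c y)))"

definition smooth_near ::
  "('a, 'e::euclidean_space) chart set \<Rightarrow> 'a \<Rightarrow> ('a \<Rightarrow> real) \<Rightarrow> bool" where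
  "smooth_near A z f \<longleftrightarrow> (\<exists>W. openin (manifold_topology A) W \<and> z \<in> W \<and> smooth_fun_on A W f)"


subsection \<open>Tangent vectors and vector fields\<close>

text \<open>Tangent vectors act as directional derivatives on the functions that are smooth near their
  base point; on all other functions they take the value 0, so that tangent vectors are equal as soon
  as they agree on the functions that are smooth near the base point.\<close>

type_synonym 'a tangent = "('a \<Rightarrow> real) \<Rightarrow> real"

definition coord_deriv ::
  "('a, 'e::euclidean_space) chart \<Rightarrow> 'e \<Rightarrow> ('a \<Rightarrow> real) \<Rightarrow> 'a \<Rightarrow> real" where
  "coord_deriv c w f z = frechet_derivative (\<lambda>y. f (chart_inv c y)) (at (chart_map c z)) w"

definition chart_vector ::
  "('a, 'e::euclidean_space) chart set \<Rightarrow> ('a, 'e) chart \<Rightarrow> 'a \<Rightarrow> 'e \<Rightarrow> 'a tangent" where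
  "chart_vector A c z w = (\<lambda>f. if smooth_near A z f then coord_deriv c w f z else 0)"

definition tangent_space ::
  "('a, 'e::euclidean_space) chart set \<Rightarrow> 'a \<Rightarrow> 'a tangent set" where
  "tangent_space A z = {chart_vector A c z w | c w. c \<in> A \<and> z \<in> chart_dom c}"

text \<open>In each chart a smooth vector field is \<open>a\<^sup>i \<partial>/\<partial>x\<^sup>i\<close> with smooth components \<open>a\<^sup>i\<close>.\<close>

definition smooth_vector_field ::
  "('a, 'e::euclidean_space) chart set \<Rightarrow> 'a set \<Rightarrow> ('a \<Rightarrow> 'a tangent) \<Rightarrow> bool" where
  "smooth_vector_field A S X \<longleftrightarrow>
     (\<forall>z\<in>S. X z \<in> tangent_space A z) \<and>
     (\<forall>c\<in>A. \<exists>a. smooth_on (chart_map c ` (chart_dom c \<inter> S)) a \<and>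
        (\<forall>z\<in>chart_dom c \<inter> S. X z = chart_vector A c z (a (chart_map c z))))"

text \<open>The velocity of an integral curve at \<open>t\<close> is the tangent vector \<open>f \<mapsto> (f \<circ> \<gamma>)'(t)\<close>.\<close>

definition integral_curve ::
  "('a, 'e::euclidean_space) chart set \<Rightarrow> 'a set \<Rightarrow> ('a \<Rightarrow> 'a tangent) \<Rightarrow>
   real set \<Rightarrow> (real \<Rightarrow> 'a) \<Rightarrow> bool" where
  "integral_curve A S X I \<gamma> \<longleftrightarrow>
     \<gamma> \<in> I \<rightarrow> S \<and>
     continuous_map (top_of_set I) (manifold_topology A) \<gamma> \<and>
     (\<forall>t\<in>I. \<forall>f. smooth_near A (\<gamma> t) f \<longrightarrow>
        ((\<lambda>s. f (\<gamma> s)) has_real_derivative X (\<gamma> t) f) (at t))"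


subsection \<open>The cotangent bundle\<close>

type_synonym 'm cotangent = "'m \<times> ('m tangent \<Rightarrow> real)"

definition cotangent_space ::
  "('m, 'e::euclidean_space) chart set \<Rightarrow> 'm \<Rightarrow> ('m tangent \<Rightarrow> real) set" where
  "cotangent_space A x =
     {\<omega> \<in> extensional (tangent_space A x).
        (\<forall>u\<in>tangent_space A x. \<forall>v\<in>tangent_space A x. \<omega> (\<lambda>f. u f + v f) = \<omega> u + \<omega> v) \<and>
        (\<forall>r. \<forall>u\<in>tangent_space A x. \<omega> (\<lambda>f. r * u f) = r * \<omega> u)}"

definition scale_cotangent ::
  "('m, 'e::euclidean_space) chart set \<Rightarrow> real \<Rightarrow> 'm cotangent \<Rightarrow> 'm cotangent" where
  "scale_cotangent A r z = (fst z, \<lambda>u\<in>tangent_space A (fst z). r * snd z u)"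

definition cotangent_bundle ::
  "('m, 'e::euclidean_space) chart set \<Rightarrow> 'm cotangent set" where
  "cotangent_bundle A = Sigma (manifold_carrier A) (cotangent_space A)"

definition zero_section ::
  "('m, 'e::euclidean_space) chart set \<Rightarrow> 'm cotangent set" where
  "zero_section A = {(x, \<lambda>u\<in>tangent_space A x. 0) | x. x \<in> manifold_carrier A}"

definition slit_cotangent_bundle ::
  "('m, 'e::euclidean_space) chart set \<Rightarrow> 'm cotangent set" where
  "slit_cotangent_bundle A = cotangent_bundle A - zero_section A"

text \<open>The coordinates \<open>x\<^sup>i\<close> and \<open>p\<^sub>i\<close> that a chart \<open>c\<close> of the base induces on the cotangent bundle; the
  momentum \<open>p\<^sub>i\<close> of a covector is its value on \<open>\<partial>/\<partial>x\<^sup>i\<close>.\<close>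

definition x_coord :: "('m, real^'n) chart \<Rightarrow> 'n \<Rightarrow> 'm cotangent \<Rightarrow> real" where
  "x_coord c i z = chart_map c (fst z) $ i"

definition p_coord ::
  "('m, real^'n) chart set \<Rightarrow> ('m, real^'n) chart \<Rightarrow> 'n \<Rightarrow> 'm cotangent \<Rightarrow> real" where
  "p_coord A c i z = snd z (chart_vector A c (fst z) (axis i 1))"

definition induced_chart ::
  "('m, real^'n) chart set \<Rightarrow> ('m, real^'n) chart \<Rightarrow> ('m cotangent, (real^'n) \<times> (real^'n)) chart" where
  "induced_chart A c =
     (Sigma (chart_dom c) (cotangent_space A),
      \<lambda>z. (\<chi> i. x_coord c i z, \<chi> i. p_coord A c i z))"

definition cotangent_atlas ::
  "('m, real^'n) chart set \<Rightarrow> ('m cotangent, (real^'n) \<times> (real^'n)) chart set" where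
  "cotangent_atlas A = induced_chart A ` A"

text \<open>Partial derivatives \<open>\<partial>f/\<partial>x\<^sup>i\<close>, \<open>\<partial>f/\<partial>p\<^sub>i\<close> and coordinate vectors \<open>\<partial>/\<partial>x\<^sup>i\<close>, \<open>\<partial>/\<partial>p\<^sub>i\<close> of an induced chart.\<close>

definition pd_x :: "('m, real^'n) chart set \<Rightarrow> ('m, real^'n) chart \<Rightarrow> 'n \<Rightarrow>
    ('m cotangent \<Rightarrow> real) \<Rightarrow> 'm cotangent \<Rightarrow> real" where
  "pd_x A c i f = coord_deriv (induced_chart A c) (axis i 1, 0) f"

definition pd_p :: "('m, real^'n) chart set \<Rightarrow> ('m, real^'n) chart \<Rightarrow> 'n \<Rightarrow>
    ('m cotangent \<Rightarrow> real) \<Rightarrow> 'm cotangent \<Rightarrow> real" where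
  "pd_p A c i f = coord_deriv (induced_chart A c) (0, axis i 1) f"

definition vec_x :: "('m, real^'n) chart set \<Rightarrow> ('m, real^'n) chart \<Rightarrow> 'n \<Rightarrow>
    'm cotangent \<Rightarrow> 'm cotangent tangent" where
  "vec_x A c i z = chart_vector (cotangent_atlas A) (induced_chart A c) z (axis i 1, 0)"

definition vec_p :: "('m, real^'n) chart set \<Rightarrow> ('m, real^'n) chart \<Rightarrow> 'n \<Rightarrow>
    'm cotangent \<Rightarrow> 'm cotangent tangent" where
  "vec_p A c i z = chart_vector (cotangent_atlas A) (induced_chart A c) z (0, axis i 1)"

text \<open>A vector is vertical if the differential of the bundle projection annihilates it.\<close>

definition vertical_vector_field ::
  "('m, real^'n) chart set \<Rightarrow> ('m cotangent \<Rightarrow> 'm cotangent tangent) \<Rightarrow> bool" where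
  "vertical_vector_field A X \<longleftrightarrow>
     smooth_vector_field (cotangent_atlas A) (cotangent_bundle A) X \<and>
     (\<forall>z\<in>cotangent_bundle A. \<forall>f. smooth_near A (fst z) f \<longrightarrow> X z (\<lambda>z'. f (fst z')) = 0)"


subsection \<open>Cartan spaces and Cartan mechanical systems\<close>

definition fundamental_tensor ::
  "('m, real^'n) chart set \<Rightarrow> ('m cotangent \<Rightarrow> real) \<Rightarrow> ('m, real^'n) chart \<Rightarrow>
   'm cotangent \<Rightarrow> real^'n^'n" where
  "fundamental_tensor A K c z =
     (\<chi> i j. 1/2 * pd_p A c i (pd_p A c j (\<lambda>z'. (K z')\<^sup>2)) z)"

definition cartan_space ::
  "('m, real^'n) chart set \<Rightarrow> ('m cotangent \<Rightarrow> real) \<Rightarrow> bool" where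
  "cartan_space A K \<longleftrightarrow>
     smooth_manifold A \<and>
     smooth_fun_on (cotangent_atlas A) (slit_cotangent_bundle A) K \<and>
     (\<forall>z\<in>zero_section A. topcontinuous_at (manifold_topology (cotangent_atlas A)) euclidean K z) \<and>
     (\<forall>z\<in>slit_cotangent_bundle A. K z > 0) \<and>
     (\<forall>z\<in>cotangent_bundle A. \<forall>r>0. K (scale_cotangent A r z) = r * K z) \<and>
     (\<forall>c\<in>A. \<forall>z\<in>slit_cotangent_bundle A. fst z \<in> chart_dom c \<longrightarrow>
        (\<forall>v. v \<noteq> 0 \<longrightarrow> v \<bullet> (fundamental_tensor A K c z *v v) > 0))"

definition cartan_mechanical_system ::
  "('m, real^'n) chart set \<Rightarrow> ('m cotangent \<Rightarrow> real) \<Rightarrow>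
   ('m cotangent \<Rightarrow> 'm cotangent tangent) \<Rightarrow> bool" where
  "cartan_mechanical_system A K Fe \<longleftrightarrow> cartan_space A K \<and> vertical_vector_field A Fe"

text \<open>The component \<open>F\<^sub>i\<close> of \<open>Fe = F\<^sub>i \<partial>/\<partial>p\<^sub>i\<close> is the value of \<open>Fe\<close> on the coordinate function \<open>p\<^sub>i\<close>.\<close>

definition force ::
  "('m, real^'n) chart set \<Rightarrow> ('m cotangent \<Rightarrow> 'm cotangent tangent) \<Rightarrow>
   ('m, real^'n) chart \<Rightarrow> 'n \<Rightarrow> 'm cotangent \<Rightarrow> real" where
  "force A Fe c i z = Fe z (p_coord A c i)"

definition local_evolution_vector ::
  "('m, real^'n) chart set \<Rightarrow> ('m cotangent \<Rightarrow> real) \<Rightarrow>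
   ('m cotangent \<Rightarrow> 'm cotangent tangent) \<Rightarrow> ('m, real^'n) chart \<Rightarrow>
   'm cotangent \<Rightarrow> 'm cotangent tangent" where
  "local_evolution_vector A K Fe c z =
     (\<lambda>f. 1/2 * (\<Sum>i\<in>UNIV.
        pd_p A c i (\<lambda>z'. (K z')\<^sup>2) z * vec_x A c i z f
        - (pd_x A c i (\<lambda>z'. (K z')\<^sup>2) z - force A Fe c i z) * vec_p A c i z f))"

definition evolution_equations_at ::
  "('m, real^'n) chart set \<Rightarrow> ('m cotangent \<Rightarrow> real) \<Rightarrow>
   ('m cotangent \<Rightarrow> 'm cotangent tangent) \<Rightarrow> ('m, real^'n) chart \<Rightarrow>
   (real \<Rightarrow> 'm cotangent) \<Rightarrow> real \<Rightarrow> bool" where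
  "evolution_equations_at A K Fe c \<gamma> t \<longleftrightarrow>
     (\<forall>i. (\<lambda>s. x_coord c i (\<gamma> s)) differentiable (at t) \<and>
          (\<lambda>s. p_coord A c i (\<gamma> s)) differentiable (at t) \<and>
          deriv (\<lambda>s. x_coord c i (\<gamma> s)) t - 1/2 * pd_p A c i (\<lambda>z. (K z)\<^sup>2) (\<gamma> t) = 0 \<and>
          deriv (\<lambda>s. p_coord A c i (\<gamma> s)) t + 1/2 * pd_x A c i (\<lambda>z. (K z)\<^sup>2) (\<gamma> t)
            = 1/2 * force A Fe c i (\<gamma> t))"

end

theory Submission
  imports Defs
begin

text \<open>
  Write \<open>H = K\<^sup>2\<close>. In every induced chart the formula for \<open>\<xi>\<close> is half the sum of two vectors:
  the Hamiltonian vector of \<open>H\<close>, with components \<open>\<partial>H/\<partial>p\<^sub>i\<close> and \<open>-\<partial>H/\<partial>x\<^sup>i\<close>, and the force \<open>Fe\<close> itself,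
  which has no \<open>\<partial>/\<partial>x\<^sup>i\<close> components because it is vertical. The force is a vector field by assumption, so
  everything rests on the Hamiltonian vector being independent of the chart.

  The Hamiltonian vector \<open>X\<close> is the only vector with \<open>\<omega>(X, Y) = dH(Y)\<close> for all \<open>Y\<close>, where
  \<open>\<omega>\<close> is the constant symplectic form of the phase space \<open>\<real>\<^sup>n \<times> \<real>\<^sup>n\<close>. Since \<open>dH(Y)\<close> does not depend on
  the chart, it suffices that the derivative of a change of induced charts preserves \<open>\<omega>\<close>
  (\<open>transition_induced_chart_symplectic\<close>). Such a change is \<open>(x, p) \<mapsto> (\<phi> x, q)\<close> with \<open>q \<bullet> b = p \<bullet> D\<psi>(\<phi> x) b\<close>,
  where \<open>\<phi>\<close> is the change of base charts and \<open>\<psi>\<close> its inverse. When \<open>\<omega>\<close> is evaluated on two images,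
  the terms with first derivatives reproduce \<open>\<omega>\<close>, because \<open>D\<psi>\<close> inverts \<open>D\<phi>\<close>, and the terms with second
  derivatives of \<open>\<psi>\<close> cancel, because second derivatives are symmetric (\<open>symmetric_second_derivative\<close>).

  The cotangent bundle has to be shown to carry a smooth atlas first
  (\<open>smooth_atlas_cotangent_atlas\<close>): a covector is determined by its momenta, which can be arbitrary, and the
  formula for \<open>q\<close> involves only a derivative of the smooth map \<open>\<psi>\<close>. Uniqueness of \<open>\<xi>\<close> is then immediate,
  as any two charts give the same vector.

  Finally, the velocity of a continuous curve is a given tangent vector if and only if its expression
  in one chart is differentiable with the components of that vector as derivative
  (\<open>velocity_in_chart\<close>). For \<open>\<xi>\<close> these component equations are the evolution equations. A curve that
  stays in one chart is continuous as soon as its coordinates are differentiable, so the evolution equations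
  in that chart are enough.
\<close>

section \<open>Calculus of smooth maps\<close>

lemma C_diff_on_cong:
  assumes "open S" "C_diff_on k S f" "\<And>x. x \<in> S \<Longrightarrow> f x = g x"
  shows "C_diff_on k S g"
  using assms(2,3)
proof (induction k arbitrary: f g)
  case 0
  then show ?case by (simp cong: continuous_on_cong)
next
  case (Suc k)
  have "(g has_derivative frechet_derivative f (at x)) (at x)" if "x \<in> S" for x
    by (rule has_derivative_transform_within_open[OF _ \<open>open S\<close> that Suc.prems(2)])
      (use Suc.prems(1) that in \<open>simp_all add: frechet_derivative_works\<close>)
  then have "g differentiable at x" "frechet_derivative f (at x) = frechet_derivative g (at x)"
    if "x \<in> S" for x
    using that by (auto simp: differentiable_def dest: frechet_derivative_at)
  moreover have "C_diff_on k S (\<lambda>x. frechet_derivative g (at x) v)" for v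
    by (rule Suc.IH[of "\<lambda>x. frechet_derivative f (at x) v"]) (use Suc.prems(1) calculation in auto)
  ultimately show ?case by simp
qed

lemma C_diff_on_SucI:
  assumes "open S"
    and der: "\<And>x. x \<in> S \<Longrightarrow> (f has_derivative f' x) (at x)"
    and "\<And>v. C_diff_on k S (\<lambda>x. f' x v)"
  shows "C_diff_on (Suc k) S f"
proof -
  have "C_diff_on k S (\<lambda>x. frechet_derivative f (at x) v)" for v
    by (rule C_diff_on_cong[OF assms(1) assms(3)[of v]]) (use frechet_derivative_at[OF der] in auto)
  then show ?thesis
    using der by (auto simp: differentiable_def)
qed

lemma C_diff_on_subset: "C_diff_on k S f \<Longrightarrow> T \<subseteq> S \<Longrightarrow> C_diff_on k T f"
  by (induction k arbitrary: f) (auto intro: continuous_on_subset)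

lemma C_diff_on_SucD: "C_diff_on (Suc k) S f \<Longrightarrow> C_diff_on k S f"
proof (induction k arbitrary: f)
  case 0
  then have "f differentiable_on S"
    by (auto simp: differentiable_on_def intro: differentiable_at_withinI)
  then show ?case by (simp add: differentiable_imp_continuous_on)
qed auto

lemma C_diff_on_SucE:
  assumes "C_diff_on (Suc k) S f" "x \<in> S"
  shows "(f has_derivative frechet_derivative f (at x)) (at x)"
  using assms by (simp add: frechet_derivative_works)

lemma C_diff_on_const: "C_diff_on k S (\<lambda>x. c)"
  by (induction k arbitrary: c) auto

lemma C_diff_on_bounded_linear:
  assumes "bounded_linear L" "open S" "C_diff_on k S f"
  shows "C_diff_on k S (\<lambda>x. L (f x))"
  using assms(3)
proof (induction k arbitrary: f)
  case 0
  then show ?case using assms(1) by (simp add: bounded_linear.continuous_on)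
next
  case (Suc k)
  show ?case
    by (rule C_diff_on_SucI[OF \<open>open S\<close> bounded_linear.has_derivative[OF assms(1) C_diff_on_SucE]])
      (use Suc assms(2) in auto)
qed

lemma C_diff_on_add:
  assumes "open S" "C_diff_on k S f" "C_diff_on k S g"
  shows "C_diff_on k S (\<lambda>x. f x + g x)"
  using assms(2,3)
proof (induction k arbitrary: f g)
  case 0
  then show ?case by (auto intro: continuous_intros)
next
  case (Suc k)
  show ?case
    by (rule C_diff_on_SucI[OF \<open>open S\<close> has_derivative_add[OF C_diff_on_SucE C_diff_on_SucE]])
      (use Suc assms(1) in auto)
qed

lemma C_diff_on_sum:
  assumes "open S" "\<And>i. i \<in> I \<Longrightarrow> C_diff_on k S (f i)"
  shows "C_diff_on k S (\<lambda>x. \<Sum>i\<in>I. f i x)"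
  using assms(2)
  by (induction I rule: infinite_finite_induct) (auto intro: C_diff_on_add C_diff_on_const assms(1))

lemma C_diff_on_bounded_bilinear:
  assumes "bounded_bilinear B" "open S" "C_diff_on k S f" "C_diff_on k S g"
  shows "C_diff_on k S (\<lambda>x. B (f x) (g x))"
  using assms(3,4)
proof (induction k arbitrary: f g)
  case 0
  then show ?case using assms(1) by (simp add: bounded_bilinear.continuous_on)
next
  case (Suc k)
  have low: "C_diff_on k S f" "C_diff_on k S g"
    using Suc.prems by (blast dest: C_diff_on_SucD)+
  show ?case
    by (rule C_diff_on_SucI[OF \<open>open S\<close> bounded_bilinear.FDERIV[OF assms(1) C_diff_on_SucE C_diff_on_SucE]])
      (use Suc low assms(2) in \<open>auto intro!: C_diff_on_add\<close>)
qed

lemma C_diff_on_ident: "C_diff_on k S (\<lambda>x. x)"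
  by (cases k) (auto simp: C_diff_on_const)

text \<open>In the chain rule \<open>Dg (f x) (Df x v)\<close> the direction depends on \<open>x\<close>. Expanding it in the standard basis
  leaves derivatives of \<open>g\<close> in fixed directions, to which the induction hypothesis applies.\<close>

lemma C_diff_on_compose:
  fixes f :: "'a::real_normed_vector \<Rightarrow> 'b::euclidean_space"
    and g :: "'b \<Rightarrow> 'c::real_normed_vector"
  assumes "open S" "f ` S \<subseteq> T" "C_diff_on k T g" "C_diff_on k S f"
  shows "C_diff_on k S (\<lambda>x. g (f x))"
  using assms(3,4)
proof (induction k arbitrary: g)
  case 0
  then show ?case
    using assms(2) by (auto intro: continuous_on_compose2)
next
  case (Suc k)
  let ?Df = "\<lambda>x. frechet_derivative f (at x)" and ?Dg = "\<lambda>y. frechet_derivative g (at y)"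
  have low: "C_diff_on k S f" using Suc.prems by (blast dest: C_diff_on_SucD)+
  show ?case
  proof (rule C_diff_on_SucI[OF \<open>open S\<close>])
    fix x assume x: "x \<in> S"
    have g: "(g has_derivative ?Dg (f x)) (at (f x))"
      using C_diff_on_SucE[OF Suc.prems(1)] x assms(2) by blast
    have "?Dg (f x) (?Df x v) = (\<Sum>b\<in>Basis. (?Df x v \<bullet> b) *\<^sub>R ?Dg (f x) b)" for v
    proof -
      have "linear (?Dg (f x))" using g has_derivative_linear by blast
      then show ?thesis
        by (subst euclidean_representation[of "?Df x v", symmetric]) (simp only: linear_sum linear_cmul)
    qed
    then show "((\<lambda>x. g (f x)) has_derivative (\<lambda>v. \<Sum>b\<in>Basis. (?Df x v \<bullet> b) *\<^sub>R ?Dg (f x) b)) (at x)"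
      using diff_chain_at[OF C_diff_on_SucE[OF Suc.prems(2) x] g] by (simp add: o_def)
  next
    fix v
    show "C_diff_on k S (\<lambda>x. \<Sum>b\<in>Basis. (?Df x v \<bullet> b) *\<^sub>R ?Dg (f x) b)"
      using Suc low assms(1)
      by (intro C_diff_on_sum C_diff_on_bounded_bilinear[OF bounded_bilinear_scaleR]
          C_diff_on_bounded_linear[OF bounded_linear_inner_left]) auto
  qed
qed

lemma smooth_on_subset: "smooth_on S f \<Longrightarrow> T \<subseteq> S \<Longrightarrow> smooth_on T f"
  by (auto simp: smooth_on_def intro: C_diff_on_subset)

lemma smooth_on_cong:
  "open S \<Longrightarrow> smooth_on S f \<Longrightarrow> (\<And>x. x \<in> S \<Longrightarrow> f x = g x) \<Longrightarrow> smooth_on S g"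
  by (auto simp: smooth_on_def intro: C_diff_on_cong)

lemma smooth_on_ident: "smooth_on S (\<lambda>x. x)"
  by (auto simp: smooth_on_def intro: C_diff_on_ident)

lemma smooth_on_bounded_linear:
  "bounded_linear L \<Longrightarrow> open S \<Longrightarrow> smooth_on S f \<Longrightarrow> smooth_on S (\<lambda>x. L (f x))"
  by (auto simp: smooth_on_def intro: C_diff_on_bounded_linear)

lemma smooth_on_add:
  "open S \<Longrightarrow> smooth_on S f \<Longrightarrow> smooth_on S g \<Longrightarrow> smooth_on S (\<lambda>x. f x + g x)"
  by (auto simp: smooth_on_def intro: C_diff_on_add)

lemma smooth_on_sum:
  "open S \<Longrightarrow> (\<And>i. i \<in> I \<Longrightarrow> smooth_on S (f i)) \<Longrightarrow> smooth_on S (\<lambda>x. \<Sum>i\<in>I. f i x)"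
  by (auto simp: smooth_on_def intro: C_diff_on_sum)

lemma smooth_on_bounded_bilinear:
  "bounded_bilinear B \<Longrightarrow> open S \<Longrightarrow> smooth_on S f \<Longrightarrow> smooth_on S g \<Longrightarrow>
    smooth_on S (\<lambda>x. B (f x) (g x))"
  by (auto simp: smooth_on_def intro: C_diff_on_bounded_bilinear)

lemma smooth_on_compose:
  fixes f :: "'a::real_normed_vector \<Rightarrow> 'b::euclidean_space"
  shows "open S \<Longrightarrow> f ` S \<subseteq> T \<Longrightarrow> smooth_on T g \<Longrightarrow> smooth_on S f \<Longrightarrow> smooth_on S (\<lambda>x. g (f x))"
  unfolding smooth_on_def by (blast intro: C_diff_on_compose)

lemma smooth_on_Pair:
  assumes "open S" "smooth_on S f" "smooth_on S g"
  shows "smooth_on S (\<lambda>x. (f x, g x))"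
proof -
  have "bounded_linear (\<lambda>y. (y, 0))" "bounded_linear (\<lambda>y. (0, y))"
    by (intro bounded_linear_Pair bounded_linear_ident bounded_linear_zero)+
  with assms have "smooth_on S (\<lambda>x. (f x, 0) + (0, g x))"
    by (intro smooth_on_add) (auto intro: smooth_on_bounded_linear)
  then show ?thesis by simp
qed

lemma smooth_on_vec:
  fixes f :: "'n::finite \<Rightarrow> 'a::real_normed_vector \<Rightarrow> real"
  assumes "open S" "\<And>i. smooth_on S (f i)"
  shows "smooth_on S (\<lambda>x. \<chi> i. f i x)"
proof -
  have "(\<lambda>x. \<chi> i. f i x) = (\<lambda>x. \<Sum>i\<in>UNIV. f i x *\<^sub>R axis i 1)"
    by (auto simp: vec_eq_iff axis_def if_distrib cong: if_cong)
  moreover have "smooth_on S (\<lambda>x. \<Sum>i\<in>UNIV. f i x *\<^sub>R axis i (1::real))"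
    using assms by (intro smooth_on_sum smooth_on_bounded_linear[OF bounded_linear_scaleR_left])
  ultimately show ?thesis by simp
qed

lemma smooth_on_frechet: "smooth_on S f \<Longrightarrow> smooth_on S (\<lambda>x. frechet_derivative f (at x) v)"
  by (metis smooth_on_def C_diff_on.simps(2))

lemma smooth_on_has_derivative:
  "smooth_on S f \<Longrightarrow> x \<in> S \<Longrightarrow> (f has_derivative frechet_derivative f (at x)) (at x)"
  unfolding smooth_on_def by (blast intro: C_diff_on_SucE)

lemma smooth_on_continuous: "smooth_on S f \<Longrightarrow> continuous_on S f"
  unfolding smooth_on_def by (metis C_diff_on.simps(1))

section \<open>Symmetry of second derivatives\<close>

text \<open>The mean value theorem is applied twice, along \<open>u\<close> to the increment in direction \<open>v\<close> and then along
  \<open>v\<close> to the derivative in direction \<open>u\<close>. The left-hand side of the equation is symmetric in \<open>u\<close> and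
  \<open>v\<close>, which is what makes it useful.\<close>

lemma second_difference_mean_value:
  fixes f :: "'a::real_normed_vector \<Rightarrow> real"
  assumes "s > 0"
    and near: "\<And>a b. a \<in> {0..s} \<Longrightarrow> b \<in> {0..s} \<Longrightarrow> x + a *\<^sub>R u + b *\<^sub>R v \<in> S"
    and f: "C_diff_on (Suc (Suc 0)) S f"
  obtains a b where "a \<in> {0..s}" "b \<in> {0..s}"
    "f (x + s *\<^sub>R u + s *\<^sub>R v) - f (x + s *\<^sub>R u) - (f (x + s *\<^sub>R v) - f x)
      = s * s * frechet_derivative (\<lambda>y. frechet_derivative f (at y) u) (at (x + a *\<^sub>R u + b *\<^sub>R v)) v"
proof -
  let ?Du = "\<lambda>y. frechet_derivative f (at y) u"
  let ?G = "\<lambda>r. f (x + r *\<^sub>R u + s *\<^sub>R v) - f (x + r *\<^sub>R u)"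
  have Du: "C_diff_on (Suc 0) S ?Du" using f by simp
  have "(?G has_derivative (\<lambda>h. h * (?Du (x + r *\<^sub>R u + s *\<^sub>R v) - ?Du (x + r *\<^sub>R u)))) (at r within {0..s})"
    if "0 \<le> r" "r \<le> s" for r
  proof -
    let ?D = "\<lambda>y. frechet_derivative f (at y)"
    have *: "((\<lambda>r. f (x + r *\<^sub>R u + b *\<^sub>R v)) has_derivative (\<lambda>h. ?D (x + r *\<^sub>R u + b *\<^sub>R v) (h *\<^sub>R u))) (at r within {0..s})"
      if "b \<in> {0..s}" for b
    proof -
      have "x + r *\<^sub>R u + b *\<^sub>R v \<in> S" using near that \<open>0 \<le> r\<close> \<open>r \<le> s\<close> by auto
      then have "(f has_derivative ?D (x + r *\<^sub>R u + b *\<^sub>R v)) (at (x + r *\<^sub>R u + b *\<^sub>R v))"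
        by (rule C_diff_on_SucE[OF f])
      moreover have "((\<lambda>r. x + r *\<^sub>R u + b *\<^sub>R v) has_derivative (\<lambda>h. h *\<^sub>R u)) (at r within {0..s})"
        by (auto intro!: derivative_eq_intros)
      ultimately show ?thesis
        by (rule has_derivative_compose[rotated])
    qed
    have lin: "?D (x + r *\<^sub>R u + b *\<^sub>R v) (h *\<^sub>R u) = h * ?Du (x + r *\<^sub>R u + b *\<^sub>R v)" if "b \<in> {0..s}" for b h
    proof -
      have "x + r *\<^sub>R u + b *\<^sub>R v \<in> S" using near that \<open>0 \<le> r\<close> \<open>r \<le> s\<close> by auto
      then have "linear (?D (x + r *\<^sub>R u + b *\<^sub>R v))"
        using C_diff_on_SucE[OF f] has_derivative_linear by blast
      then show ?thesis by (simp add: linear_cmul)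
    qed
    show ?thesis
      using has_derivative_diff[OF *[of s] *[of 0]] lin[of 0] lin[of s] assms(1)
      by (simp add: algebra_simps)
  qed
  from mvt_very_simple[OF less_imp_le[OF \<open>s > 0\<close>] this] 
  obtain a where a: "a \<in> {0..s}"
    and ga: "?G s - ?G 0 = s * (?Du (x + a *\<^sub>R u + s *\<^sub>R v) - ?Du (x + a *\<^sub>R u))"
    by auto
  let ?D = "\<lambda>y. frechet_derivative ?Du (at y)"
  have S: "x + a *\<^sub>R u + b *\<^sub>R v \<in> S" if "0 \<le> b" "b \<le> s" for b using near that a by auto
  have "((\<lambda>b. ?Du (x + a *\<^sub>R u + b *\<^sub>R v)) has_derivative (\<lambda>h. ?D (x + a *\<^sub>R u + b *\<^sub>R v) (h *\<^sub>R v))) (at b within {0..s})"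
    if "0 \<le> b" "b \<le> s" for b
  proof -
    have "((\<lambda>b. x + a *\<^sub>R u + b *\<^sub>R v) has_derivative (\<lambda>h. h *\<^sub>R v)) (at b within {0..s})"
      by (auto intro!: derivative_eq_intros)
    moreover have "(?Du has_derivative ?D (x + a *\<^sub>R u + b *\<^sub>R v)) (at (x + a *\<^sub>R u + b *\<^sub>R v))"
      by (rule C_diff_on_SucE[OF Du S[OF that]])
    ultimately show ?thesis
      by (rule has_derivative_compose)
  qed
  from mvt_very_simple[OF less_imp_le[OF \<open>s > 0\<close>] this] 
  obtain b where b: "b \<in> {0..s}"
    and gb: "?Du (x + a *\<^sub>R u + s *\<^sub>R v) - ?Du (x + a *\<^sub>R u) = ?D (x + a *\<^sub>R u + b *\<^sub>R v) (s *\<^sub>R v)"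
    by auto
  have "linear (?D (x + a *\<^sub>R u + b *\<^sub>R v))"
    by (rule has_derivative_linear[OF C_diff_on_SucE[OF Du S]]) (use b in auto)
  then show thesis
    using that[OF a b] ga gb by (simp add: linear_cmul algebra_simps)
qed

text \<open>Both mixed derivatives are limits of the same second difference quotient: by the preceding lemma the
  quotient is a value of either one at points of the parallelogram with sides \<open>s u\<close> and \<open>s v\<close>, and
  these points tend to \<open>x\<close> as \<open>s\<close> tends to 0.\<close>

lemma symmetric_second_derivative_real:
  fixes f :: "'a::real_normed_vector \<Rightarrow> real"
  assumes "open S" "smooth_on S f" "x \<in> S"
  shows "frechet_derivative (\<lambda>y. frechet_derivative f (at y) u) (at x) v
       = frechet_derivative (\<lambda>y. frechet_derivative f (at y) v) (at x) u"
    (is "?P u v x = ?P v u x")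
proof -
  have f: "C_diff_on (Suc (Suc 0)) S f" using assms(2) unfolding smooth_on_def by blast
  have cont: "continuous_on S (?P a b)" for a b using f by simp
  define sq where "sq s = {x + a *\<^sub>R u + b *\<^sub>R v | a b. a \<in> {0..s} \<and> b \<in> {0..s}}" for s :: real
  obtain e where "e > 0" and e: "ball x e \<subseteq> S" using assms by (meson openE)
  \<comment> \<open>The parallelogram \<open>sq s\<close> lies in the ball of radius \<open>s * m\<close> around \<open>x\<close>; the summand 1 makes
    \<open>m\<close> positive even if \<open>u = v = 0\<close>.\<close>
  define m where "m = norm u + norm v + 1"
  have "m > 0" unfolding m_def by (smt (verit) norm_ge_zero)
  have sq: "dist z x < d" if z: "z \<in> sq s" and "s > 0" "s < d / m" for z s d
  proof -
    from z obtain a b where ab: "a \<in> {0..s}" "b \<in> {0..s}" and "z = x + a *\<^sub>R u + b *\<^sub>R v"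
      unfolding sq_def by auto
    then have "dist z x = norm (a *\<^sub>R u + b *\<^sub>R v)" by (simp add: dist_norm add.assoc)
    also have "\<dots> \<le> a * norm u + b * norm v"
      using ab norm_triangle_ineq[of "a *\<^sub>R u" "b *\<^sub>R v"] by auto
    also have "\<dots> \<le> s * norm u + s * norm v"
      using ab by (intro add_mono mult_right_mono) auto
    also have "\<dots> < s * m" using \<open>s > 0\<close> by (simp add: m_def algebra_simps)
    also have "\<dots> < d" using \<open>s < d / m\<close> \<open>m > 0\<close> by (simp add: field_simps)
    finally show ?thesis .
  qed
  have "\<bar>?P u v x - ?P v u x\<bar> \<le> eps" if "eps > 0" for eps
  proof -
    have "\<exists>d>0. \<forall>y\<in>S. dist y x < d \<longrightarrow> dist (?P a b y) (?P a b x) < eps / 2" for a b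
      using cont[of a b] assms(3) \<open>eps > 0\<close> unfolding continuous_on_iff by (meson half_gt_zero)
    then obtain d1 d2 where d: "d1 > 0" "d2 > 0"
      and d1: "\<And>y. y \<in> S \<Longrightarrow> dist y x < d1 \<Longrightarrow> dist (?P u v y) (?P u v x) < eps / 2"
      and d2: "\<And>y. y \<in> S \<Longrightarrow> dist y x < d2 \<Longrightarrow> dist (?P v u y) (?P v u x) < eps / 2"
      by metis
    \<comment> \<open>So small that \<open>sq s\<close> stays inside \<open>S\<close> and both mixed derivatives vary by less than \<open>eps / 2\<close> on it.\<close>
    define s where "s = min e (min d1 d2) / m / 2"
    have "min e (min d1 d2) / m > 0" using d \<open>e > 0\<close> \<open>m > 0\<close> by simp
    then have s: "s > 0" "s < min e (min d1 d2) / m" unfolding s_def by auto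
    have near: "z \<in> S \<and> dist z x < d1 \<and> dist z x < d2" if "z \<in> sq s" for z
      using sq[OF that s] e by (auto simp: dist_commute)
    obtain a b where ab: "a \<in> {0..s}" "b \<in> {0..s}" and
      1: "f (x + s *\<^sub>R u + s *\<^sub>R v) - f (x + s *\<^sub>R u) - (f (x + s *\<^sub>R v) - f x)
        = s * s * ?P u v (x + a *\<^sub>R u + b *\<^sub>R v)"
      using second_difference_mean_value[OF s(1) _ f, of x u v] near unfolding sq_def by blast
    have near': "x + b *\<^sub>R v + a *\<^sub>R u \<in> S" if "a \<in> {0..s}" "b \<in> {0..s}" for a b
      using near[of "x + a *\<^sub>R u + b *\<^sub>R v"] that unfolding sq_def by (auto simp: algebra_simps)
    obtain a' b' where ab': "a' \<in> {0..s}" "b' \<in> {0..s}" and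
      2: "f (x + s *\<^sub>R v + s *\<^sub>R u) - f (x + s *\<^sub>R v) - (f (x + s *\<^sub>R u) - f x)
        = s * s * ?P v u (x + a' *\<^sub>R v + b' *\<^sub>R u)"
      using second_difference_mean_value[OF s(1) _ f, of x v u] near' by blast
    have "s * s * ?P u v (x + a *\<^sub>R u + b *\<^sub>R v) = s * s * ?P v u (x + b' *\<^sub>R u + a' *\<^sub>R v)"
      using 1 2 by (simp add: algebra_simps)
    then have "?P u v (x + a *\<^sub>R u + b *\<^sub>R v) = ?P v u (x + b' *\<^sub>R u + a' *\<^sub>R v)"
      using s(1) by simp
    moreover have "x + a *\<^sub>R u + b *\<^sub>R v \<in> sq s" "x + b' *\<^sub>R u + a' *\<^sub>R v \<in> sq s"
      using ab ab' unfolding sq_def by blast+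
    ultimately show ?thesis
      using d1[of "x + a *\<^sub>R u + b *\<^sub>R v"] d2[of "x + b' *\<^sub>R u + a' *\<^sub>R v"] near
      by (smt (verit) dist_real_def field_sum_of_halves)
  qed
  then have "\<bar>?P u v x - ?P v u x\<bar> \<le> 0" by (rule field_le_epsilon) simp
  then show ?thesis by simp
qed

text \<open>Inner products with fixed vectors reduce this to real-valued functions.\<close>

lemma symmetric_second_derivative:
  fixes f :: "'a::real_normed_vector \<Rightarrow> 'b::real_inner"
  assumes "open S" "smooth_on S f" "x \<in> S"
  shows "frechet_derivative (\<lambda>y. frechet_derivative f (at y) u) (at x) v
       = frechet_derivative (\<lambda>y. frechet_derivative f (at y) v) (at x) u"
proof -
  have first: "frechet_derivative (\<lambda>y. g y \<bullet> w) (at y) a = frechet_derivative g (at y) a \<bullet> w"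
    if "smooth_on S g" "y \<in> S" for g :: "'a \<Rightarrow> 'b" and a w y
    using frechet_derivative_at[OF has_derivative_inner_left[OF smooth_on_has_derivative[OF that]], of w]
    by metis
  have second: "frechet_derivative (\<lambda>y. frechet_derivative (\<lambda>y. f y \<bullet> w) (at y) a) (at x) b
      = frechet_derivative (\<lambda>y. frechet_derivative f (at y) a) (at x) b \<bullet> w" for a b w
  proof -
    have "((\<lambda>y. frechet_derivative f (at y) a \<bullet> w) has_derivative
        (\<lambda>b. frechet_derivative (\<lambda>y. frechet_derivative f (at y) a) (at x) b \<bullet> w)) (at x)"
      by (intro has_derivative_inner_left smooth_on_has_derivative[OF smooth_on_frechet[OF assms(2)] assms(3)])
    then have "((\<lambda>y. frechet_derivative (\<lambda>y. f y \<bullet> w) (at y) a) has_derivative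
        (\<lambda>b. frechet_derivative (\<lambda>y. frechet_derivative f (at y) a) (at x) b \<bullet> w)) (at x)"
      by (rule has_derivative_transform_within_open[OF _ assms(1,3)]) (simp add: first assms(2))
    then show ?thesis by (simp add: frechet_derivative_at[symmetric])
  qed
  have "smooth_on S (\<lambda>y. f y \<bullet> w)" for w
    by (intro smooth_on_bounded_linear[OF bounded_linear_inner_left] assms)
  from symmetric_second_derivative_real[OF assms(1) this assms(3)]
  show ?thesis
    unfolding second by (metis vector_eq_rdot)
qed

section \<open>Manifolds with a smooth atlas\<close>

abbreviation transition :: "('a, 'e) chart \<Rightarrow> ('a, 'e) chart \<Rightarrow> 'e \<Rightarrow> 'e" where
  "transition c d \<equiv> \<lambda>y. chart_map d (chart_inv c y)"

lemma chart_inv_in_dom: "y \<in> chart_map c ` chart_dom c \<Longrightarrow> chart_inv c y \<in> chart_dom c"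
  unfolding chart_inv_def by (rule inv_into_into)

lemma chart_map_chart_inv: "y \<in> chart_map c ` chart_dom c \<Longrightarrow> chart_map c (chart_inv c y) = y"
  unfolding chart_inv_def by (rule f_inv_into_f)

locale atlas =
  fixes A :: "('a, 'e::euclidean_space) chart set"
  assumes smooth_atlas: "smooth_atlas A"
begin

lemma inj_on_chart: "c \<in> A \<Longrightarrow> inj_on (chart_map c) (chart_dom c)"
  using smooth_atlas unfolding smooth_atlas_def by blast

lemma open_chart_range: "c \<in> A \<Longrightarrow> open (chart_map c ` chart_dom c)"
  using smooth_atlas unfolding smooth_atlas_def by blast

lemma open_overlap: "c \<in> A \<Longrightarrow> d \<in> A \<Longrightarrow> open (chart_map c ` (chart_dom c \<inter> chart_dom d))"
  using smooth_atlas unfolding smooth_atlas_def by blast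

lemma smooth_transition:
  "c \<in> A \<Longrightarrow> d \<in> A \<Longrightarrow> smooth_on (chart_map c ` (chart_dom c \<inter> chart_dom d)) (transition c d)"
  using smooth_atlas unfolding smooth_atlas_def by blast

lemma chart_inv_chart_map [simp]: "c \<in> A \<Longrightarrow> z \<in> chart_dom c \<Longrightarrow> chart_inv c (chart_map c z) = z"
  unfolding chart_inv_def by (rule inv_into_f_f[OF inj_on_chart])

text \<open>The sets whose images under all charts are open form a topology, and it contains the generators because
  transition maps are continuous.\<close>

lemma open_chart_image:
  assumes "c \<in> A" and W: "openin (manifold_topology A) W"
  shows "open (chart_map c ` (chart_dom c \<inter> W))"
proof -
  let ?T = "\<lambda>W. \<forall>c\<in>A. open (chart_map c ` (chart_dom c \<inter> W))"
  have top: "istopology ?T"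
    unfolding istopology_def
  proof (intro conjI allI impI ballI)
    fix S T c assume *: "?T S" "?T T" "c \<in> A"
    then have "chart_map c ` (chart_dom c \<inter> (S \<inter> T)) =
        chart_map c ` (chart_dom c \<inter> S) \<inter> chart_map c ` (chart_dom c \<inter> T)"
      using inj_on_image_Int[OF inj_on_chart[of c], of "chart_dom c \<inter> S" "chart_dom c \<inter> T"]
      by (simp add: Int_ac)
    then show "open (chart_map c ` (chart_dom c \<inter> (S \<inter> T)))" using * by (simp add: open_Int)
  next
    fix \<K> c assume *: "\<forall>K\<in>\<K>. ?T K" "c \<in> A"
    have "chart_map c ` (chart_dom c \<inter> \<Union>\<K>) = (\<Union>K\<in>\<K>. chart_map c ` (chart_dom c \<inter> K))" by auto
    then show "open (chart_map c ` (chart_dom c \<inter> \<Union>\<K>))" using * by (simp add: open_UN)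
  qed
  have basis: "?T s" if s: "s \<in> {chart_dom d \<inter> chart_map d -` W | d W. d \<in> A \<and> open W}" for s
  proof
    fix c assume "c \<in> A"
    from s obtain d V where s: "s = chart_dom d \<inter> chart_map d -` V" and "d \<in> A" "open V" by blast
    have "chart_map c ` (chart_dom c \<inter> s) =
        transition c d -` V \<inter> chart_map c ` (chart_dom c \<inter> chart_dom d)"
      using \<open>c \<in> A\<close> s by auto
    then show "open (chart_map c ` (chart_dom c \<inter> s))"
      using iffD1[OF continuous_on_open_vimage[OF open_overlap[of c d]]
          smooth_on_continuous[OF smooth_transition[of c d]]] \<open>c \<in> A\<close> \<open>d \<in> A\<close> \<open>open V\<close> by simp
  qed
  have "?T W"
    by (rule generate_topology_on_coarsest[OF top basis
          openin_topology_generated_by[OF W[unfolded manifold_topology_def]]])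
  with \<open>c \<in> A\<close> show ?thesis by blast
qed

lemma openin_chart_preimage:
  assumes "c \<in> A" "open V"
  shows "openin (manifold_topology A) (chart_dom c \<inter> chart_map c -` V)"
  unfolding manifold_topology_def using assms by (intro topology_generated_by_Basis) blast

lemma openin_chart_dom: "c \<in> A \<Longrightarrow> openin (manifold_topology A) (chart_dom c)"
  using openin_chart_preimage[of c UNIV] by simp

lemma topspace_manifold_topology: "topspace (manifold_topology A) = manifold_carrier A"
proof (rule antisym)
  show "topspace (manifold_topology A) \<subseteq> manifold_carrier A"
    unfolding manifold_topology_def manifold_carrier_def by auto
  show "manifold_carrier A \<subseteq> topspace (manifold_topology A)"
    unfolding manifold_carrier_def using openin_subset[OF openin_chart_dom] by blast
qed

lemma openin_if_open_chart_image:
  assumes "c \<in> A" "U \<subseteq> chart_dom c" "open (chart_map c ` U)"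
  shows "openin (manifold_topology A) U"
proof -
  have "U = chart_dom c \<inter> chart_map c -` (chart_map c ` U)"
    using assms inj_onD[OF inj_on_chart[OF assms(1)]] by blast
  then show ?thesis using openin_chart_preimage[OF assms(1,3)] by simp
qed

lemma smooth_near_in_chart:
  assumes "smooth_near A z f" "c \<in> A" "z \<in> chart_dom c"
  obtains V where "open V" "chart_map c z \<in> V" "V \<subseteq> chart_map c ` chart_dom c"
    "smooth_on V (\<lambda>y. f (chart_inv c y))"
proof -
  obtain W where W: "openin (manifold_topology A) W" "z \<in> W" "smooth_fun_on A W f"
    using assms(1) unfolding smooth_near_def by blast
  show thesis
    by (rule that[of "chart_map c ` (chart_dom c \<inter> W)"])
      (use W assms open_chart_image in \<open>auto simp: smooth_fun_on_def\<close>)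
qed

lemma smooth_near_has_derivative:
  assumes "smooth_near A z f" "c \<in> A" "z \<in> chart_dom c"
  shows "((\<lambda>y. f (chart_inv c y)) has_derivative (\<lambda>w. chart_vector A c z w f)) (at (chart_map c z))"
proof -
  obtain V where "chart_map c z \<in> V" "smooth_on V (\<lambda>y. f (chart_inv c y))"
    using smooth_near_in_chart[OF assms] by metis
  from smooth_on_has_derivative[OF this(2,1)] assms(1) show ?thesis
    by (simp add: chart_vector_def coord_deriv_def)
qed

lemma chart_vector_linear:
  assumes "c \<in> A" "z \<in> chart_dom c"
  shows "linear (\<lambda>w. chart_vector A c z w f)"
proof (cases "smooth_near A z f")
  case True
  then show ?thesis using smooth_near_has_derivative assms has_derivative_linear by blast
next
  case False
  then show ?thesis by (simp add: chart_vector_def linear_iff)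
qed

text \<open>Read in any other chart such a function is the composition of \<open>h\<close> with a transition map. These are the
  test functions that recover the components of a tangent vector.\<close>

lemma smooth_near_coordinate_function:
  assumes "c \<in> A" "z \<in> chart_dom c" "smooth_on (chart_map c ` chart_dom c) h"
  shows "smooth_near A z (\<lambda>x. h (chart_map c x))"
  unfolding smooth_near_def smooth_fun_on_def
proof (intro exI[of _ "chart_dom c"] conjI ballI)
  fix d assume "d \<in> A"
  show "smooth_on (chart_map d ` (chart_dom d \<inter> chart_dom c)) (\<lambda>y. h (transition d c y))"
    by (rule smooth_on_compose[OF open_overlap _ assms(3) smooth_transition])
      (use \<open>d \<in> A\<close> assms(1) in auto)
qed (use assms openin_chart_dom in auto)

lemma chart_vector_coordinate_function:
  assumes "c \<in> A" "z \<in> chart_dom c" "smooth_on (chart_map c ` chart_dom c) h"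
  shows "chart_vector A c z w (\<lambda>x. h (chart_map c x)) = frechet_derivative h (at (chart_map c z)) w"
proof -
  have "(h has_derivative (\<lambda>w. chart_vector A c z w (\<lambda>x. h (chart_map c x)))) (at (chart_map c z))"
    by (rule has_derivative_transform_within_open
        [OF smooth_near_has_derivative[OF smooth_near_coordinate_function] open_chart_range])
      (use assms in \<open>auto simp: chart_map_chart_inv\<close>)
  then show ?thesis by (simp add: frechet_derivative_at[symmetric])
qed

lemma smooth_near_inner_chart:
  "c \<in> A \<Longrightarrow> z \<in> chart_dom c \<Longrightarrow> smooth_near A z (\<lambda>x. chart_map c x \<bullet> b)"
  by (intro smooth_near_coordinate_function smooth_on_bounded_linear[OF bounded_linear_inner_left]
      open_chart_range smooth_on_ident)

lemma chart_vector_inner_chart: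
  assumes "c \<in> A" "z \<in> chart_dom c"
  shows "chart_vector A c z w (\<lambda>x. chart_map c x \<bullet> b) = w \<bullet> b"
proof -
  have "((\<lambda>y. y \<bullet> b) has_derivative (\<lambda>w. w \<bullet> b)) (at (chart_map c z))"
    by (auto intro!: derivative_eq_intros)
  then have "frechet_derivative (\<lambda>y. y \<bullet> b) (at (chart_map c z)) w = w \<bullet> b"
    using frechet_derivative_at by metis
  with chart_vector_coordinate_function[OF assms, of "\<lambda>y. y \<bullet> b"] show ?thesis
    by (simp add: smooth_on_bounded_linear[OF bounded_linear_inner_left]
        open_chart_range assms smooth_on_ident)
qed

lemma chart_vector_inject:
  assumes "c \<in> A" "z \<in> chart_dom c"
  shows "chart_vector A c z v = chart_vector A c z w \<longleftrightarrow> v = w"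
proof
  assume "chart_vector A c z v = chart_vector A c z w"
  then have "v \<bullet> b = w \<bullet> b" for b
    using chart_vector_inner_chart[OF assms] by metis
  then show "v = w" by (auto intro: euclidean_eqI)
qed simp

lemma transition_has_derivative:
  assumes "c \<in> A" "d \<in> A" "z \<in> chart_dom c" "z \<in> chart_dom d"
  shows "(transition c d has_derivative frechet_derivative (transition c d) (at (chart_map c z)))
    (at (chart_map c z))"
  by (rule smooth_on_has_derivative[OF smooth_transition]) (use assms in auto)

lemma chart_vector_change:
  assumes "c \<in> A" "d \<in> A" "z \<in> chart_dom c" "z \<in> chart_dom d"
  shows "chart_vector A c z w =
    chart_vector A d z (frechet_derivative (transition c d) (at (chart_map c z)) w)"
proof
  fix f
  show "chart_vector A c z w f =
    chart_vector A d z (frechet_derivative (transition c d) (at (chart_map c z)) w) f"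
  proof (cases "smooth_near A z f")
    case True
    let ?D = "frechet_derivative (transition c d) (at (chart_map c z))"
    have "((\<lambda>y. f (chart_inv d (transition c d y))) has_derivative (\<lambda>w. chart_vector A d z (?D w) f))
        (at (chart_map c z))"
      by (rule has_derivative_compose[OF transition_has_derivative[OF assms]])
        (use smooth_near_has_derivative[OF True] assms in simp)
    then have "((\<lambda>y. f (chart_inv c y)) has_derivative (\<lambda>w. chart_vector A d z (?D w) f))
        (at (chart_map c z))"
      by (rule has_derivative_transform_within_open[OF _ open_overlap[OF assms(1,2)]])
        (use assms in auto)
    then show ?thesis
      using smooth_near_has_derivative[OF True assms(1,3)] has_derivative_unique by metis
  qed (simp add: chart_vector_def)
qed

text \<open>Passing from \<open>c\<close> to \<open>d\<close> and back does not change the tangent vector, and a tangent vector determines its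
  components.\<close>

lemma transition_derivative_inverse:
  assumes "c \<in> A" "d \<in> A" "z \<in> chart_dom c" "z \<in> chart_dom d"
  shows "frechet_derivative (transition d c) (at (chart_map d z))
    (frechet_derivative (transition c d) (at (chart_map c z)) w) = w"
  using chart_vector_change[OF assms, of w] chart_vector_change[OF assms(2,1,4,3)]
    chart_vector_inject[OF assms(1,3)]
  by metis

lemma tangent_space_eq:
  assumes "c \<in> A" "z \<in> chart_dom c"
  shows "tangent_space A z = range (chart_vector A c z)"
proof
  show "tangent_space A z \<subseteq> range (chart_vector A c z)"
    unfolding tangent_space_def using chart_vector_change assms by (smt (verit) mem_Collect_eq range_eqI subsetI)
  show "range (chart_vector A c z) \<subseteq> tangent_space A z"
    unfolding tangent_space_def using assms by blast
qed

lemma continuous_map_if_continuous_in_chart: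
  assumes "c \<in> A" "\<gamma> \<in> I \<rightarrow> chart_dom c" "continuous_on I (\<lambda>s. chart_map c (\<gamma> s))"
  shows "continuous_map (top_of_set I) (manifold_topology A) \<gamma>"
  unfolding continuous_map_def
proof (intro conjI allI impI)
  show "\<gamma> \<in> topspace (top_of_set I) \<rightarrow> topspace (manifold_topology A)"
    using assms(1,2) by (auto simp: topspace_manifold_topology manifold_carrier_def)
next
  fix U assume U: "openin (manifold_topology A) U"
  have "{s \<in> I. \<gamma> s \<in> U} = I \<inter> (\<lambda>s. chart_map c (\<gamma> s)) -` (chart_map c ` (chart_dom c \<inter> U))"
    using assms(2) inj_onD[OF inj_on_chart[OF assms(1)]] by blast
  then show "openin (top_of_set I) {s \<in> topspace (top_of_set I). \<gamma> s \<in> U}"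
    using continuous_openin_preimage_gen[OF assms(3) open_chart_image[OF assms(1) U]] by simp
qed

text \<open>From left to right, the coordinate functions of the chart are taken as test functions. From right to
  left this is the chain rule for \<open>f \<circ> c\<^sup>-\<^sup>1\<close> and \<open>c \<circ> \<gamma>\<close>; continuity of \<open>\<gamma>\<close> keeps it inside the chart for
  times close to \<open>t\<close>, so that their composition is \<open>f \<circ> \<gamma>\<close> there.\<close>

lemma velocity_in_chart:
  assumes "c \<in> A" "open I" "t \<in> I" "\<gamma> t \<in> chart_dom c"
    and cont: "continuous_map (top_of_set I) (manifold_topology A) \<gamma>"
  shows "(\<forall>f. smooth_near A (\<gamma> t) f \<longrightarrow>
        ((\<lambda>s. f (\<gamma> s)) has_real_derivative chart_vector A c (\<gamma> t) w f) (at t))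
      \<longleftrightarrow> ((\<lambda>s. chart_map c (\<gamma> s)) has_vector_derivative w) (at t)"
proof
  assume "\<forall>f. smooth_near A (\<gamma> t) f \<longrightarrow>
    ((\<lambda>s. f (\<gamma> s)) has_real_derivative chart_vector A c (\<gamma> t) w f) (at t)"
  then have "((\<lambda>s. chart_map c (\<gamma> s) \<bullet> b) has_real_derivative w \<bullet> b) (at t)" for b
    using smooth_near_inner_chart[OF assms(1,4), of b] chart_vector_inner_chart[OF assms(1,4), of w b]
    by force
  then show "((\<lambda>s. chart_map c (\<gamma> s)) has_vector_derivative w) (at t)"
    unfolding has_vector_derivative_def
    by (subst has_derivative_componentwise_within) (simp add: has_field_derivative_def mult_commute_abs)
next
  assume R: "((\<lambda>s. chart_map c (\<gamma> s)) has_vector_derivative w) (at t)"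
  define J where "J = {s \<in> I. \<gamma> s \<in> chart_dom c}"
  have "openin (top_of_set I) J"
    using cont openin_chart_dom[OF assms(1)] unfolding continuous_map_def J_def by simp
  then have "open J" using \<open>open I\<close> openin_open_trans by blast
  show "\<forall>f. smooth_near A (\<gamma> t) f \<longrightarrow>
    ((\<lambda>s. f (\<gamma> s)) has_real_derivative chart_vector A c (\<gamma> t) w f) (at t)"
  proof (intro allI impI)
    fix f assume f: "smooth_near A (\<gamma> t) f"
    have "((\<lambda>s. f (chart_inv c (chart_map c (\<gamma> s)))) has_derivative
        (\<lambda>h. chart_vector A c (\<gamma> t) (h *\<^sub>R w) f)) (at t)"
      by (rule has_derivative_compose[OF R[unfolded has_vector_derivative_def]
            smooth_near_has_derivative[OF f assms(1,4)]])
    then have "((\<lambda>s. f (\<gamma> s)) has_derivative (\<lambda>h. chart_vector A c (\<gamma> t) (h *\<^sub>R w) f)) (at t)"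
      by (rule has_derivative_transform_within_open[OF _ \<open>open J\<close>])
        (use assms in \<open>auto simp: J_def\<close>)
    then show "((\<lambda>s. f (\<gamma> s)) has_real_derivative chart_vector A c (\<gamma> t) w f) (at t)"
      using linear_cmul[OF chart_vector_linear[OF assms(1,4)]]
      by (simp add: has_field_derivative_def mult_commute_abs)
  qed
qed

end

section \<open>The smooth atlas of the cotangent bundle\<close>

text \<open>The inverse of an induced chart: the covector over \<open>x\<close> with momenta \<open>p\<close>. On \<open>tangent_space A x\<close>, the
  inverse of \<open>chart_vector A c x\<close> reads off components in the chart \<open>c\<close>.\<close>

definition covector ::
  "('m, real^'n) chart set \<Rightarrow> ('m, real^'n) chart \<Rightarrow> 'm \<Rightarrow> real^'n \<Rightarrow> 'm cotangent" where
  "covector A c x p = (x, \<lambda>u\<in>tangent_space A x. p \<bullet> inv (chart_vector A c x) u)"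

lemma fst_covector [simp]: "fst (covector A c x p) = x"
  by (simp add: covector_def)

lemma chart_dom_induced_chart: "chart_dom (induced_chart A c) = Sigma (chart_dom c) (cotangent_space A)"
  by (simp add: induced_chart_def)

lemma chart_map_induced_chart:
  "chart_map (induced_chart A c) z = (chart_map c (fst z), \<chi> i. p_coord A c i z)"
  by (simp add: induced_chart_def x_coord_def)

locale base_atlas =
  fixes A :: "('m, real^'n) chart set"
  assumes base_smooth_atlas: "smooth_atlas A"

sublocale base_atlas \<subseteq> base: atlas A
  by unfold_locales (rule base_smooth_atlas)

context base_atlas
begin

text \<open>By linearity a covector is determined by its values on the coordinate vectors, which are its momenta.\<close>

lemma cotangent_on_chart_vector:
  assumes "c \<in> A" "z \<in> chart_dom (induced_chart A c)"
  shows "snd z (chart_vector A c (fst z) w) = snd (chart_map (induced_chart A c) z) \<bullet> w"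
proof -
  let ?X = "chart_vector A c (fst z)"
  have z: "fst z \<in> chart_dom c" "snd z \<in> cotangent_space A (fst z)"
    using assms(2) by (auto simp: chart_dom_induced_chart)
  have T: "?X v \<in> tangent_space A (fst z)" for v
    using base.tangent_space_eq[OF assms(1) z(1)] by simp
  have add: "?X (v + w) = (\<lambda>f. ?X v f + ?X w f)" and scale: "?X (r *\<^sub>R v) = (\<lambda>f. r * ?X v f)" for v w r
    using linear_add[OF base.chart_vector_linear[OF assms(1) z(1)]]
      linear_cmul[OF base.chart_vector_linear[OF assms(1) z(1)]] by auto
  have lin: "linear (\<lambda>v. snd z (?X v))"
  proof (rule linearI)
    show "snd z (?X (v + w)) = snd z (?X v) + snd z (?X w)" for v w
      unfolding add using z(2) T by (simp add: cotangent_space_def)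
    show "snd z (?X (r *\<^sub>R v)) = r *\<^sub>R snd z (?X v)" for r v
      unfolding scale using z(2) T by (simp add: cotangent_space_def)
  qed
  have w: "w = (\<Sum>i\<in>UNIV. w $ i *\<^sub>R axis i 1)"
    by (simp add: vec_eq_iff axis_def if_distrib cong: if_cong)
  have "snd z (?X w) = (\<Sum>i\<in>UNIV. w $ i * snd z (?X (axis i 1)))"
    by (subst w) (simp add: linear_sum[OF lin] linear_cmul[OF lin])
  then show ?thesis
    by (simp add: chart_map_induced_chart p_coord_def inner_vec_def mult.commute)
qed

lemma covector_on_chart_vector:
  assumes "c \<in> A" "x \<in> chart_dom c"
  shows "snd (covector A c x p) (chart_vector A c x w) = p \<bullet> w"
proof -
  have "inj (chart_vector A c x)"
    using base.chart_vector_inject[OF assms] by (auto intro: injI)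
  then show ?thesis
    by (simp add: covector_def base.tangent_space_eq[OF assms])
qed

lemma covector_in_chart_dom:
  assumes "c \<in> A" "x \<in> chart_dom c"
  shows "covector A c x p \<in> chart_dom (induced_chart A c)"
proof -
  let ?X = "chart_vector A c x" and ?w = "snd (covector A c x p)"
  have add: "?X (v + w) = (\<lambda>f. ?X v f + ?X w f)" and scale: "?X (r *\<^sub>R v) = (\<lambda>f. r * ?X v f)" for v w r
    using linear_add[OF base.chart_vector_linear[OF assms]]
      linear_cmul[OF base.chart_vector_linear[OF assms]] by auto
  have "?w (\<lambda>f. ?X v f + ?X w f) = ?w (?X v) + ?w (?X w)" "?w (\<lambda>f. r * ?X v f) = r * ?w (?X v)" for v w r
    unfolding add[symmetric] scale[symmetric] covector_on_chart_vector[OF assms]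
    by (simp_all add: inner_add_right)
  moreover have "?w \<in> extensional (tangent_space A x)" by (simp add: covector_def)
  ultimately have "?w \<in> cotangent_space A x"
    by (auto simp: cotangent_space_def base.tangent_space_eq[OF assms])
  then show ?thesis
    using assms(2) SigmaI[of x "chart_dom c" "snd (covector A c x p)" "cotangent_space A"]
    by (simp add: chart_dom_induced_chart covector_def del: mem_Sigma_iff)
qed

lemma chart_map_covector:
  assumes "c \<in> A" "x \<in> chart_dom c"
  shows "chart_map (induced_chart A c) (covector A c x p) = (chart_map c x, p)"
  unfolding chart_map_induced_chart p_coord_def fst_covector covector_on_chart_vector[OF assms]
  by (simp add: vec_eq_iff inner_axis)

lemma covector_eqI:
  assumes "c \<in> A" "z \<in> chart_dom (induced_chart A c)" "z' \<in> chart_dom (induced_chart A c)"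
    and eq: "chart_map (induced_chart A c) z = chart_map (induced_chart A c) z'"
  shows "z = z'"
proof -
  have dom: "fst z \<in> chart_dom c" "fst z' \<in> chart_dom c"
    using assms(2,3) by (auto simp: chart_dom_induced_chart)
  moreover have "chart_map c (fst z) = chart_map c (fst z')"
    using eq by (simp add: chart_map_induced_chart)
  ultimately have x: "fst z = fst z'" "fst z \<in> chart_dom c"
    using inj_onD[OF base.inj_on_chart[OF assms(1)]] by blast+
  have "snd z u = snd z' u" if "u \<in> tangent_space A (fst z)" for u
  proof -
    from that obtain w where u: "u = chart_vector A c (fst z) w"
      unfolding base.tangent_space_eq[OF assms(1) x(2)] by (rule rangeE)
    have "snd z u = snd (chart_map (induced_chart A c) z) \<bullet> w"
      unfolding u by (rule cotangent_on_chart_vector[OF assms(1,2)])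
    also have "\<dots> = snd z' u"
      unfolding u eq x(1) by (rule cotangent_on_chart_vector[OF assms(1,3), symmetric])
    finally show ?thesis .
  qed
  moreover have "snd z \<in> extensional (tangent_space A (fst z))" "snd z' \<in> extensional (tangent_space A (fst z))"
    using assms(2,3) x by (auto simp: chart_dom_induced_chart cotangent_space_def)
  ultimately have "snd z = snd z'" by (blast intro: extensionalityI)
  then show ?thesis using x by (simp add: prod_eq_iff)
qed

lemma inj_on_induced_chart:
  "c \<in> A \<Longrightarrow> inj_on (chart_map (induced_chart A c)) (chart_dom (induced_chart A c))"
  by (blast intro: inj_onI covector_eqI)

lemma chart_image_over:
  assumes "c \<in> A" "U \<subseteq> chart_dom c"
  shows "chart_map (induced_chart A c) ` Sigma U (cotangent_space A) = (chart_map c ` U) \<times> UNIV"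
proof
  show "chart_map (induced_chart A c) ` Sigma U (cotangent_space A) \<subseteq> (chart_map c ` U) \<times> UNIV"
    by (auto simp: chart_map_induced_chart)
  show "(chart_map c ` U) \<times> UNIV \<subseteq> chart_map (induced_chart A c) ` Sigma U (cotangent_space A)"
  proof
    fix y :: "(real^'n) \<times> (real^'n)" assume "y \<in> (chart_map c ` U) \<times> UNIV"
    then obtain x p where x: "x \<in> U" and y: "y = (chart_map c x, p)" by auto
    then have "covector A c x p \<in> Sigma U (cotangent_space A)"
      using covector_in_chart_dom[OF assms(1), of x p] assms(2)
      by (auto simp: chart_dom_induced_chart covector_def)
    then show "y \<in> chart_map (induced_chart A c) ` Sigma U (cotangent_space A)"
      using chart_map_covector[OF assms(1), of x p] assms(2) x y by (metis image_eqI subsetD)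
  qed
qed

lemma chart_inv_induced_chart:
  assumes "c \<in> A" "y \<in> (chart_map c ` chart_dom c) \<times> UNIV"
  shows "chart_inv (induced_chart A c) y = covector A c (chart_inv c (fst y)) (snd y)"
proof -
  have x: "chart_inv c (fst y) \<in> chart_dom c" "chart_map c (chart_inv c (fst y)) = fst y"
    using assms(2) by (auto simp: chart_inv_in_dom chart_map_chart_inv)
  have "y = chart_map (induced_chart A c) (covector A c (chart_inv c (fst y)) (snd y))"
    using chart_map_covector[OF assms(1) x(1)] x(2) by simp
  then show ?thesis
    unfolding chart_inv_def[of "induced_chart A c"]
    using inv_into_f_f[OF inj_on_induced_chart[OF assms(1)] covector_in_chart_dom[OF assms(1) x(1)]]
    by metis
qed

text \<open>The vector with components \<open>b\<close> in \<open>d\<close> has components \<open>D(c \<circ> d\<^sup>-\<^sup>1) b\<close> in \<open>c\<close>; a covector takes the same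
  value whichever chart is used to write it.\<close>

lemma momentum_change:
  assumes "c \<in> A" "d \<in> A" "z \<in> chart_dom (induced_chart A c)" "z \<in> chart_dom (induced_chart A d)"
  shows "snd (chart_map (induced_chart A d) z) \<bullet> b =
    snd (chart_map (induced_chart A c) z) \<bullet>
      frechet_derivative (transition d c) (at (chart_map d (fst z))) b"
proof -
  have "fst z \<in> chart_dom c" "fst z \<in> chart_dom d"
    using assms(3,4) by (auto simp: chart_dom_induced_chart)
  then show ?thesis
    using cotangent_on_chart_vector[OF assms(1,3)] cotangent_on_chart_vector[OF assms(2,4)]
      base.chart_vector_change[OF assms(2,1)] by metis
qed

lemma overlap_image_induced_chart:
  assumes "c \<in> A"
  shows "chart_map (induced_chart A c) ` (chart_dom (induced_chart A c) \<inter> chart_dom (induced_chart A d))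
    = (chart_map c ` (chart_dom c \<inter> chart_dom d)) \<times> UNIV"
proof -
  have "chart_dom (induced_chart A c) \<inter> chart_dom (induced_chart A d)
      = Sigma (chart_dom c \<inter> chart_dom d) (cotangent_space A)"
    by (auto simp: chart_dom_induced_chart)
  then show ?thesis using chart_image_over[OF assms] by simp
qed

lemma transition_induced_chart:
  assumes "c \<in> A" "d \<in> A" "y \<in> (chart_map c ` (chart_dom c \<inter> chart_dom d)) \<times> UNIV"
  shows "transition (induced_chart A c) (induced_chart A d) y =
    (transition c d (fst y),
     \<chi> i. snd y \<bullet> frechet_derivative (transition d c) (at (transition c d (fst y))) (axis i 1))"
proof -
  obtain x p where x: "x \<in> chart_dom c" "x \<in> chart_dom d" and y: "y = (chart_map c x, p)"
    using assms(3) by auto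
  have inv: "chart_inv (induced_chart A c) y = covector A c x p"
    using chart_inv_induced_chart[OF assms(1), of y] assms(1) x y by auto
  have dom: "covector A c x p \<in> chart_dom (induced_chart A c)"
    using covector_in_chart_dom[OF assms(1) x(1)] .
  then have "covector A c x p \<in> chart_dom (induced_chart A d)"
    using x(2) by (auto simp: chart_dom_induced_chart covector_def)
  from momentum_change[OF assms(1,2) dom this, of "axis i 1" for i]
  have "snd (chart_map (induced_chart A d) (covector A c x p)) $ i =
      p \<bullet> frechet_derivative (transition d c) (at (chart_map d x)) (axis i 1)" for i
    by (simp add: chart_map_covector[OF assms(1) x(1)] inner_axis)
  moreover have "fst (chart_map (induced_chart A d) (covector A c x p)) = chart_map d x"
    by (simp add: chart_map_induced_chart)
  ultimately show ?thesis
    unfolding y inv[unfolded y] by (intro prod_eqI) (simp_all add: assms(1) x vec_eq_iff)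
qed

lemma smooth_atlas_cotangent_atlas: "smooth_atlas (cotangent_atlas A)"
proof -
  have "inj_on (chart_map (induced_chart A c)) (chart_dom (induced_chart A c))"
    and "open (chart_map (induced_chart A c) ` chart_dom (induced_chart A c))" if "c \<in> A" for c
    using inj_on_induced_chart[OF that] chart_image_over[OF that order_refl] base.open_chart_range[OF that]
    by (simp_all add: chart_dom_induced_chart open_Times)
  moreover have "open (chart_map (induced_chart A c) `
        (chart_dom (induced_chart A c) \<inter> chart_dom (induced_chart A d)))" (is "open ?S")
    and "smooth_on (chart_map (induced_chart A c) `
        (chart_dom (induced_chart A c) \<inter> chart_dom (induced_chart A d)))
      (transition (induced_chart A c) (induced_chart A d))"
    if "c \<in> A" "d \<in> A" for c d
  proof -
    let ?U = "chart_map c ` (chart_dom c \<inter> chart_dom d)"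
    let ?V = "chart_map d ` (chart_dom d \<inter> chart_dom c)"
    note S = overlap_image_induced_chart[OF that(1), of d]
    show open_S: "open ?S"
      unfolding S by (intro open_Times base.open_overlap that open_UNIV)
    then have o: "open (?U \<times> (UNIV :: (real^'n) set))" unfolding S .
    have fst: "smooth_on (?U \<times> (UNIV :: (real^'n) set)) (\<lambda>y. transition c d (fst y))"
      by (rule smooth_on_compose[OF o _ base.smooth_transition[OF that]
            smooth_on_bounded_linear[OF bounded_linear_fst o smooth_on_ident]]) auto
    have "smooth_on (?U \<times> (UNIV :: (real^'n) set))
        (\<lambda>y. frechet_derivative (transition d c) (at (transition c d (fst y))) b)" for b
      by (rule smooth_on_compose[OF o _ smooth_on_frechet[OF base.smooth_transition[OF that(2,1)]] fst])
        (use that in auto)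
    then have "smooth_on (?U \<times> (UNIV :: (real^'n) set)) (\<lambda>y. (transition c d (fst y),
       \<chi> i. snd y \<bullet> frechet_derivative (transition d c) (at (transition c d (fst y))) (axis i 1)))"
      by (intro smooth_on_Pair smooth_on_vec smooth_on_bounded_bilinear[OF bounded_bilinear_inner]
          smooth_on_bounded_linear[OF bounded_linear_snd] smooth_on_ident o fst)
    then show "smooth_on ?S (transition (induced_chart A c) (induced_chart A d))"
      unfolding S
      by (rule smooth_on_cong[OF o]) (use transition_induced_chart[OF that] in simp)
  qed
  ultimately show ?thesis
    unfolding smooth_atlas_def cotangent_atlas_def by blast
qed

end

sublocale base_atlas \<subseteq> cot: atlas "cotangent_atlas A"
  by unfold_locales (rule smooth_atlas_cotangent_atlas)

context base_atlas
begin

lemma induced_chart_in_cotangent_atlas: "c \<in> A \<Longrightarrow> induced_chart A c \<in> cotangent_atlas A"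
  by (simp add: cotangent_atlas_def)

lemma in_induced_chart_dom:
  "z \<in> cotangent_bundle A \<Longrightarrow> z \<in> chart_dom (induced_chart A c) \<longleftrightarrow> fst z \<in> chart_dom c"
  by (auto simp: cotangent_bundle_def chart_dom_induced_chart)

lemma induced_chart_dom_subset: "c \<in> A \<Longrightarrow> chart_dom (induced_chart A c) \<subseteq> cotangent_bundle A"
  by (auto simp: cotangent_bundle_def chart_dom_induced_chart manifold_carrier_def)

text \<open>This turns the removal of the zero section into an open condition in each induced chart.\<close>

lemma slit_iff_momentum_nonzero:
  assumes "c \<in> A" "z \<in> chart_dom (induced_chart A c)"
  shows "z \<in> slit_cotangent_bundle A \<longleftrightarrow> snd (chart_map (induced_chart A c) z) \<noteq> 0"
proof -
  have x: "fst z \<in> chart_dom c" using assms(2) by (auto simp: chart_dom_induced_chart)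
  have zero: "covector A c (fst z) 0 = (fst z, \<lambda>u\<in>tangent_space A (fst z). 0)"
    by (simp add: covector_def)
  have "z \<in> zero_section A \<longleftrightarrow> z = covector A c (fst z) 0"
    unfolding zero using assms(1) x by (auto simp: zero_section_def manifold_carrier_def)
  also have "\<dots> \<longleftrightarrow> snd (chart_map (induced_chart A c) z) = 0"
  proof
    assume "z = covector A c (fst z) 0"
    then show "snd (chart_map (induced_chart A c) z) = 0"
      using chart_map_covector[OF assms(1) x, of 0] by simp
  next
    assume "snd (chart_map (induced_chart A c) z) = 0"
    moreover have "fst (chart_map (induced_chart A c) z) = chart_map c (fst z)"
      by (simp add: chart_map_induced_chart)
    ultimately show "z = covector A c (fst z) 0"
      by (intro covector_eqI[OF assms covector_in_chart_dom[OF assms(1) x]])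
        (simp add: chart_map_covector[OF assms(1) x] prod_eq_iff)
  qed
  finally show ?thesis
    using subsetD[OF induced_chart_dom_subset[OF assms(1)] assms(2)]
    by (auto simp: slit_cotangent_bundle_def)
qed

lemma open_slit_image:
  assumes "c \<in> A"
  shows "open (chart_map (induced_chart A c) ` (chart_dom (induced_chart A c) \<inter> slit_cotangent_bundle A))"
proof -
  let ?C = "induced_chart A c"
  have "chart_map ?C ` (chart_dom ?C \<inter> slit_cotangent_bundle A)
      = chart_map ?C ` chart_dom ?C \<inter> UNIV \<times> (- {0})"
  proof (intro set_eqI iffI)
    fix y assume "y \<in> chart_map ?C ` chart_dom ?C \<inter> UNIV \<times> (- {0})"
    then obtain z where "z \<in> chart_dom ?C" "y = chart_map ?C z" "snd (chart_map ?C z) \<noteq> 0"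
      by (auto simp: mem_Times_iff)
    with slit_iff_momentum_nonzero[OF assms] show "y \<in> chart_map ?C ` (chart_dom ?C \<inter> slit_cotangent_bundle A)"
      by blast
  qed (use slit_iff_momentum_nonzero[OF assms] in \<open>auto simp: mem_Times_iff\<close>)
  then show ?thesis
    using cot.open_chart_range[OF induced_chart_in_cotangent_atlas[OF assms]]
    by (simp add: open_Int open_Times open_Compl)
qed

lemma openin_slit: "openin (manifold_topology (cotangent_atlas A)) (slit_cotangent_bundle A)"
proof -
  have "openin (manifold_topology (cotangent_atlas A))
      (chart_dom (induced_chart A c) \<inter> slit_cotangent_bundle A)" if "c \<in> A" for c
    by (rule cot.openin_if_open_chart_image[OF induced_chart_in_cotangent_atlas[OF that] _ open_slit_image[OF that]])
      auto
  then have "openin (manifold_topology (cotangent_atlas A))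
      (\<Union>c\<in>A. chart_dom (induced_chart A c) \<inter> slit_cotangent_bundle A)"
    by (intro openin_Union) auto
  moreover have "(\<Union>c\<in>A. chart_dom (induced_chart A c) \<inter> slit_cotangent_bundle A) = slit_cotangent_bundle A"
    by (auto simp: slit_cotangent_bundle_def cotangent_bundle_def chart_dom_induced_chart manifold_carrier_def)
  ultimately show ?thesis by simp
qed

end

section \<open>Hamiltonian vectors do not depend on the chart\<close>

definition symplectic_form :: "('v::real_inner \<times> 'v) \<Rightarrow> 'v \<times> 'v \<Rightarrow> real" where
  "symplectic_form X Y = fst X \<bullet> snd Y - snd X \<bullet> fst Y"

lemma symplectic_form_nondegenerate:
  assumes "\<And>Y. symplectic_form X Y = symplectic_form X' Y"
  shows "X = X'"
proof (rule prod_eqI)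
  have "fst X \<bullet> b = fst X' \<bullet> b" for b
    using assms[of "(0, b)"] by (simp add: symplectic_form_def)
  then show "fst X = fst X'" by (metis vector_eq_rdot)
  have "snd X \<bullet> b = snd X' \<bullet> b" for b
    using assms[of "(b, 0)"] by (simp add: symplectic_form_def)
  then show "snd X = snd X'" by (metis vector_eq_rdot)
qed

context base_atlas
begin

text \<open>The derivative is computed from \<open>fst (\<Phi> v) = \<phi> (fst v)\<close> and \<open>snd (\<Phi> v) \<bullet> b = snd v \<bullet> D\<psi> (fst (\<Phi> v)) b\<close>, where
  \<open>\<Phi>\<close> is the change of induced charts and \<open>\<phi>\<close> that of the base charts. The momentum enters linearly and
  \<open>D\<psi>\<close> is differentiated once more, which produces the second derivative of \<open>\<psi>\<close>.\<close>

lemma transition_induced_chart_derivative: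
  assumes "c \<in> A" "d \<in> A" and z: "z \<in> chart_dom (induced_chart A c)" "z \<in> chart_dom (induced_chart A d)"
  defines "D \<equiv> frechet_derivative (transition (induced_chart A c) (induced_chart A d))
      (at (chart_map (induced_chart A c) z))"
    and "\<psi> \<equiv> transition d c" and "y \<equiv> chart_map d (fst z)"
    and "p \<equiv> snd (chart_map (induced_chart A c) z)"
  shows "fst (D X) = frechet_derivative (transition c d) (at (chart_map c (fst z))) (fst X)"
    and "snd (D X) \<bullet> b = snd X \<bullet> frechet_derivative \<psi> (at y) b
      + p \<bullet> frechet_derivative (\<lambda>w. frechet_derivative \<psi> (at w) b) (at y) (fst (D X))"
proof -
  let ?C = "induced_chart A c" and ?D = "induced_chart A d"
  let ?\<Phi> = "transition ?C ?D" and ?\<phi> = "transition c d"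
  let ?S = "chart_map ?C ` (chart_dom ?C \<inter> chart_dom ?D)"
  have x: "fst z \<in> chart_dom c" "fst z \<in> chart_dom d"
    using z by (auto simp: chart_dom_induced_chart)
  have m: "chart_map ?C z = (chart_map c (fst z), p)"
    by (simp add: p_def chart_map_induced_chart)
  note C = induced_chart_in_cotangent_atlas[OF assms(1)] induced_chart_in_cotangent_atlas[OF assms(2)]
  have open_S: "open ?S" and zS: "chart_map ?C z \<in> ?S"
    using cot.open_overlap[OF C] z by auto
  have \<Phi>: "(?\<Phi> has_derivative D) (at (chart_map ?C z))"
    unfolding D_def by (rule cot.transition_has_derivative[OF C z])
  have \<phi>: "(?\<phi> has_derivative frechet_derivative ?\<phi> (at (chart_map c (fst z)))) (at (fst (chart_map ?C z)))"
    using base.transition_has_derivative[OF assms(1,2) x] by (simp add: m)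
  have fst_\<Phi>: "fst (?\<Phi> v) = ?\<phi> (fst v)" if "v \<in> ?S" for v
    using transition_induced_chart[OF assms(1,2)] that
    unfolding overlap_image_induced_chart[OF assms(1)] by simp
  have fst_D: "(\<lambda>X. fst (D X)) = (\<lambda>X. frechet_derivative ?\<phi> (at (chart_map c (fst z))) (fst X))"
  proof (rule has_derivative_unique)
    show "((\<lambda>v. fst (?\<Phi> v)) has_derivative (\<lambda>X. fst (D X))) (at (chart_map ?C z))"
      by (rule has_derivative_fst[OF \<Phi>])
    show "((\<lambda>v. fst (?\<Phi> v)) has_derivative (\<lambda>X. frechet_derivative ?\<phi> (at (chart_map c (fst z))) (fst X)))
        (at (chart_map ?C z))"
      by (rule has_derivative_transform_within_open[OF
            has_derivative_compose[OF has_derivative_fst[OF has_derivative_ident] \<phi>] open_S zS])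
        (simp add: fst_\<Phi>)
  qed
  then show "fst (D X) = frechet_derivative ?\<phi> (at (chart_map c (fst z))) (fst X)"
    by meson
  let ?G = "\<lambda>w. frechet_derivative \<psi> (at w) b"
  have snd_\<Phi>: "snd (?\<Phi> v) \<bullet> b = snd v \<bullet> ?G (fst (?\<Phi> v))" if "v \<in> ?S" for v
  proof -
    from that obtain z' where z': "z' \<in> chart_dom ?C" "z' \<in> chart_dom ?D" "v = chart_map ?C z'"
      by blast
    then have "?\<Phi> v = chart_map ?D z'" using C by simp
    moreover have "fst (chart_map ?D z') = chart_map d (fst z')"
      by (simp add: chart_map_induced_chart)
    ultimately show ?thesis
      using momentum_change[OF assms(1,2) z'(1,2)] z'(3) by (simp add: \<psi>_def)
  qed
  have "?\<Phi> (chart_map ?C z) = chart_map ?D z" using C z by simp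
  then have y: "fst (?\<Phi> (chart_map ?C z)) = y"
    by (simp add: y_def chart_map_induced_chart[of A d])
  have "smooth_on (chart_map d ` (chart_dom d \<inter> chart_dom c)) ?G"
    unfolding \<psi>_def by (rule smooth_on_frechet[OF base.smooth_transition[OF assms(2,1)]])
  then have G: "(?G has_derivative frechet_derivative ?G (at y)) (at (fst (?\<Phi> (chart_map ?C z))))"
    unfolding y by (rule smooth_on_has_derivative) (use x in \<open>auto simp: y_def\<close>)
  have "(\<lambda>X. snd (D X) \<bullet> b) = (\<lambda>X. p \<bullet> frechet_derivative ?G (at y) (fst (D X)) + snd X \<bullet> ?G y)"
  proof (rule has_derivative_unique)
    show "((\<lambda>v. snd (?\<Phi> v) \<bullet> b) has_derivative (\<lambda>X. snd (D X) \<bullet> b)) (at (chart_map ?C z))"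
      by (intro has_derivative_inner_left has_derivative_snd \<Phi>)
    have "((\<lambda>v. snd v \<bullet> ?G (fst (?\<Phi> v))) has_derivative
        (\<lambda>X. p \<bullet> frechet_derivative ?G (at y) (fst (D X)) + snd X \<bullet> ?G y)) (at (chart_map ?C z))"
      using has_derivative_inner[OF has_derivative_snd[OF has_derivative_ident]
          has_derivative_compose[OF has_derivative_fst[OF \<Phi>] G]]
      by (simp add: y p_def)
    then show "((\<lambda>v. snd (?\<Phi> v) \<bullet> b) has_derivative
        (\<lambda>X. p \<bullet> frechet_derivative ?G (at y) (fst (D X)) + snd X \<bullet> ?G y)) (at (chart_map ?C z))"
      by (rule has_derivative_transform_within_open[OF _ open_S zS]) (simp add: snd_\<Phi>)
  qed
  then show "snd (D X) \<bullet> b = snd X \<bullet> ?G y + p \<bullet> frechet_derivative ?G (at y) (fst (D X))"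
    by (metis (no_types, lifting) add.commute)
qed

text \<open>The first-derivative terms pair \<open>D\<psi>\<close> with \<open>D\<phi>\<close>, which are inverse to each other, and leave the symplectic
  form of \<open>X\<close> and \<open>Y\<close>. The second-derivative terms cancel by symmetry.\<close>

lemma transition_induced_chart_symplectic:
  assumes "c \<in> A" "d \<in> A" and z: "z \<in> chart_dom (induced_chart A c)" "z \<in> chart_dom (induced_chart A d)"
  defines "D \<equiv> frechet_derivative (transition (induced_chart A c) (induced_chart A d))
      (at (chart_map (induced_chart A c) z))"
  shows "symplectic_form (D X) (D Y) = symplectic_form X Y"
proof -
  define \<psi> where "\<psi> = transition d c"
  define y where "y = chart_map d (fst z)"
  define p where "p = snd (chart_map (induced_chart A c) z)"
  let ?D2 = "\<lambda>a b. p \<bullet> frechet_derivative (\<lambda>w. frechet_derivative \<psi> (at w) b) (at y) a"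
  note der = transition_induced_chart_derivative[OF assms(1,2) z, folded D_def \<psi>_def y_def p_def]
  have x: "fst z \<in> chart_dom c" "fst z \<in> chart_dom d"
    using z by (auto simp: chart_dom_induced_chart)
  have inv: "frechet_derivative \<psi> (at y) (fst (D Z)) = fst Z" for Z
    unfolding der(1) \<psi>_def y_def by (rule base.transition_derivative_inverse[OF assms(1,2) x])
  have sym: "?D2 a b = ?D2 b a" for a b
    using symmetric_second_derivative[OF base.open_overlap base.smooth_transition, of d c y]
      assms(1,2) x unfolding \<psi>_def y_def by simp
  have "symplectic_form (D X) (D Y)
      = (snd Y \<bullet> fst X + ?D2 (fst (D Y)) (fst (D X))) - (snd X \<bullet> fst Y + ?D2 (fst (D X)) (fst (D Y)))"
    unfolding symplectic_form_def inner_commute[of "fst (D X)"] der(2) inv ..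
  then show ?thesis
    using sym by (simp add: symplectic_form_def inner_commute)
qed

definition hamiltonian_coords ::
  "('m, real^'n) chart \<Rightarrow> ('m cotangent \<Rightarrow> real) \<Rightarrow> 'm cotangent \<Rightarrow> (real^'n) \<times> (real^'n)" where
  "hamiltonian_coords c H z = (\<chi> i. vec_p A c i z H, \<chi> i. - vec_x A c i z H)"

lemma induced_chart_vector_sum:
  fixes Y :: "(real^'n) \<times> (real^'n)"
  assumes "c \<in> A" "z \<in> chart_dom (induced_chart A c)"
  shows "chart_vector (cotangent_atlas A) (induced_chart A c) z Y f =
    (\<Sum>i\<in>UNIV. fst Y $ i * vec_x A c i z f + snd Y $ i * vec_p A c i z f)"
proof -
  let ?L = "\<lambda>Y. chart_vector (cotangent_atlas A) (induced_chart A c) z Y f"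
  have lin: "linear ?L"
    by (rule cot.chart_vector_linear[OF induced_chart_in_cotangent_atlas[OF assms(1)] assms(2)])
  have Y: "Y = (\<Sum>i\<in>UNIV. (fst Y $ i) *\<^sub>R (axis i 1, 0) + (snd Y $ i) *\<^sub>R (0, axis i 1))"
    by (simp add: prod_eq_iff fst_sum snd_sum vec_eq_iff axis_def if_distrib cong: if_cong)
  show ?thesis
    by (subst Y) (simp add: linear_sum[OF lin] linear_add[OF lin] linear_cmul[OF lin] vec_x_def vec_p_def
        del: scaleR_Pair add_Pair)
qed

text \<open>The chart-free characterisation of the Hamiltonian vector: its contraction with the symplectic form is
  the differential of \<open>H\<close>.\<close>

lemma symplectic_form_hamiltonian_coords:
  assumes "c \<in> A" "z \<in> chart_dom (induced_chart A c)"
  shows "symplectic_form (hamiltonian_coords c H z) Y =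
    chart_vector (cotangent_atlas A) (induced_chart A c) z Y H"
  unfolding induced_chart_vector_sum[OF assms]
  by (simp add: symplectic_form_def hamiltonian_coords_def inner_vec_def sum.distrib sum_negf mult.commute)

text \<open>The transformed vector and the vector computed in \<open>d\<close> have the same contraction with the symplectic form,
  namely the differential of \<open>H\<close>, and the form is nondegenerate.\<close>

lemma hamiltonian_vector_chart_independent:
  assumes "c \<in> A" "d \<in> A" and z: "z \<in> chart_dom (induced_chart A c)" "z \<in> chart_dom (induced_chart A d)"
  shows "chart_vector (cotangent_atlas A) (induced_chart A c) z (hamiltonian_coords c H z)
    = chart_vector (cotangent_atlas A) (induced_chart A d) z (hamiltonian_coords d H z)"
proof -
  let ?C = "induced_chart A c" and ?D = "induced_chart A d"
  note C = induced_chart_in_cotangent_atlas[OF assms(1)] induced_chart_in_cotangent_atlas[OF assms(2)]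
  let ?J = "frechet_derivative (transition ?C ?D) (at (chart_map ?C z))"
  let ?J' = "frechet_derivative (transition ?D ?C) (at (chart_map ?D z))"
  have "?J (hamiltonian_coords c H z) = hamiltonian_coords d H z"
  proof (rule symplectic_form_nondegenerate)
    fix Y
    have Y: "?J (?J' Y) = Y"
      by (rule cot.transition_derivative_inverse[OF C(2,1) z(2,1)])
    have "symplectic_form (?J (hamiltonian_coords c H z)) Y
        = symplectic_form (hamiltonian_coords c H z) (?J' Y)"
      using transition_induced_chart_symplectic[OF assms(1,2) z, of "hamiltonian_coords c H z" "?J' Y"]
      by (simp only: Y)
    also have "\<dots> = chart_vector (cotangent_atlas A) ?D z Y H"
      unfolding symplectic_form_hamiltonian_coords[OF assms(1) z(1)]
        cot.chart_vector_change[OF C z] Y ..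
    also have "\<dots> = symplectic_form (hamiltonian_coords d H z) Y"
      by (rule symplectic_form_hamiltonian_coords[OF assms(2) z(2), symmetric])
    finally show "symplectic_form (?J (hamiltonian_coords c H z)) Y
        = symplectic_form (hamiltonian_coords d H z) Y" .
  qed
  then show ?thesis
    using cot.chart_vector_change[OF C z, of "hamiltonian_coords c H z"] by simp
qed

end

section \<open>Evolution equations and vertical forces in coordinates\<close>

lemma ball_Basis_phase_space:
  "(\<forall>b\<in>(Basis :: ((real^'n) \<times> (real^'n)) set). P b) \<longleftrightarrow> (\<forall>i. P (axis i 1, 0) \<and> P (0, axis i 1))"
proof -
  have Basis: "(Basis :: ((real^'n) \<times> (real^'n)) set) = (\<Union>i. {(axis i 1, 0), (0, axis i 1)})"
    unfolding Basis_prod_def Basis_vec_def by auto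
  show ?thesis unfolding Basis by blast
qed

lemma has_vector_derivative_phase_space_iff:
  fixes g :: "real \<Rightarrow> (real^'n) \<times> (real^'n)"
  shows "(g has_vector_derivative v) (at t) \<longleftrightarrow>
    (\<forall>i. ((\<lambda>s. fst (g s) $ i) has_real_derivative fst v $ i) (at t) \<and>
         ((\<lambda>s. snd (g s) $ i) has_real_derivative snd v $ i) (at t))"
proof -
  have "(g has_vector_derivative v) (at t) \<longleftrightarrow>
      (\<forall>b\<in>Basis. ((\<lambda>s. g s \<bullet> b) has_real_derivative v \<bullet> b) (at t))"
    unfolding has_vector_derivative_def
    by (subst has_derivative_componentwise_within) (simp add: has_field_derivative_def mult_commute_abs)
  also have "\<dots> \<longleftrightarrow> (\<forall>i. ((\<lambda>s. g s \<bullet> (axis i 1, 0)) has_real_derivative v \<bullet> (axis i 1, 0)) (at t) \<and>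
      ((\<lambda>s. g s \<bullet> (0, axis i 1)) has_real_derivative v \<bullet> (0, axis i 1)) (at t))"
    by (rule ball_Basis_phase_space)
  also have "\<dots> \<longleftrightarrow> (\<forall>i. ((\<lambda>s. fst (g s) $ i) has_real_derivative fst v $ i) (at t) \<and>
         ((\<lambda>s. snd (g s) $ i) has_real_derivative snd v $ i) (at t))"
    by (simp add: inner_prod_def inner_axis)
  finally show ?thesis .
qed

text \<open>The components of \<open>\<xi>\<close> in an induced chart, that is, the right-hand side of the evolution equations
  once these are solved for the derivatives.\<close>

definition evolution_coords ::
  "('m, real^'n) chart set \<Rightarrow> ('m cotangent \<Rightarrow> real) \<Rightarrow> ('m cotangent \<Rightarrow> 'm cotangent tangent) \<Rightarrow>
   ('m, real^'n) chart \<Rightarrow> 'm cotangent \<Rightarrow> (real^'n) \<times> (real^'n)" where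
  "evolution_coords A K Fe c z =
     (\<chi> i. 1/2 * pd_p A c i (\<lambda>z'. (K z')\<^sup>2) z,
      \<chi> i. - 1/2 * pd_x A c i (\<lambda>z'. (K z')\<^sup>2) z + 1/2 * force A Fe c i z)"

lemma evolution_equations_at_iff:
  "evolution_equations_at A K Fe c \<gamma> t \<longleftrightarrow>
    ((\<lambda>s. chart_map (induced_chart A c) (\<gamma> s)) has_vector_derivative evolution_coords A K Fe c (\<gamma> t)) (at t)"
proof -
  have *: "f differentiable (at t) \<and> deriv f t = v \<longleftrightarrow> (f has_real_derivative v) (at t)" for f v
    using DERIV_deriv_iff_real_differentiable DERIV_imp_deriv real_differentiable_def by metis
  have eqs: "a - b = 0 \<longleftrightarrow> a = b" "a + 1/2 * b = 1/2 * c' \<longleftrightarrow> a = - 1/2 * b + 1/2 * c'" for a b c' :: real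
    by (auto simp: field_simps)
  show ?thesis
    unfolding has_vector_derivative_phase_space_iff evolution_equations_at_def
    by (simp only: chart_map_induced_chart fst_conv snd_conv vec_lambda_beta evolution_coords_def
        *[symmetric] eqs x_coord_def) blast
qed

context base_atlas
begin

lemma local_evolution_vector_eq:
  assumes "c \<in> A" "z \<in> chart_dom (induced_chart A c)"
  shows "local_evolution_vector A K Fe c z =
    chart_vector (cotangent_atlas A) (induced_chart A c) z (evolution_coords A K Fe c z)"
proof
  fix f
  show "local_evolution_vector A K Fe c z f =
    chart_vector (cotangent_atlas A) (induced_chart A c) z (evolution_coords A K Fe c z) f"
    unfolding induced_chart_vector_sum[OF assms] local_evolution_vector_def sum_distrib_left
    by (rule sum.cong) (auto simp: evolution_coords_def algebra_simps diff_divide_distrib add_divide_distrib)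
qed

text \<open>The base coordinates are functions on the base, so a vertical vector annihilates them and has no
  \<open>\<partial>/\<partial>x\<^sup>i\<close> components. Its \<open>\<partial>/\<partial>p\<^sub>i\<close> components are its values on the coordinates \<open>p\<^sub>i\<close>.\<close>

lemma vertical_vector_field_in_chart:
  assumes "vertical_vector_field A X" "c \<in> A"
  shows "\<And>z. z \<in> chart_dom (induced_chart A c) \<Longrightarrow>
      X z = chart_vector (cotangent_atlas A) (induced_chart A c) z (0, \<chi> i. force A X c i z)"
    and "smooth_on (chart_map (induced_chart A c) ` chart_dom (induced_chart A c))
      (\<lambda>y. (0::real^'n, \<chi> i. force A X c i (chart_inv (induced_chart A c) y)))"
proof -
  let ?C = "induced_chart A c"
  note C = induced_chart_in_cotangent_atlas[OF assms(2)]
  have "chart_dom ?C \<inter> cotangent_bundle A = chart_dom ?C"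
    using induced_chart_dom_subset[OF assms(2)] by blast
  then obtain a where smooth: "smooth_on (chart_map ?C ` chart_dom ?C) a"
    and a: "\<And>z. z \<in> chart_dom ?C \<Longrightarrow> X z = chart_vector (cotangent_atlas A) ?C z (a (chart_map ?C z))"
    using assms(1) C unfolding vertical_vector_field_def smooth_vector_field_def by metis
  have a_eq: "a (chart_map ?C z) = (0, \<chi> i. force A X c i z)" if z: "z \<in> chart_dom ?C" for z
  proof (rule prod_eqI)
    have x: "fst z \<in> chart_dom c" "z \<in> cotangent_bundle A"
      using z induced_chart_dom_subset[OF assms(2)] by (auto simp: chart_dom_induced_chart)
    have "fst (a (chart_map ?C z)) $ i = 0" for i
    proof -
      have "X z (\<lambda>z'. chart_map c (fst z') \<bullet> axis i 1) = 0"
        using assms(1) x(2) base.smooth_near_inner_chart[OF assms(2) x(1)]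
        unfolding vertical_vector_field_def by blast
      then show ?thesis
        using cot.chart_vector_inner_chart[OF C z, of "a (chart_map ?C z)" "(axis i 1, 0)"] a[OF z]
        by (simp add: inner_prod_def chart_map_induced_chart inner_axis)
    qed
    then show "fst (a (chart_map ?C z)) = fst (0, \<chi> i. force A X c i z)"
      by (simp add: vec_eq_iff)
    have "snd (a (chart_map ?C z)) $ i = force A X c i z" for i
      using cot.chart_vector_inner_chart[OF C z, of "a (chart_map ?C z)" "(0, axis i 1)"] a[OF z]
      by (simp add: inner_prod_def chart_map_induced_chart inner_axis force_def)
    then show "snd (a (chart_map ?C z)) = snd (0::real^'n, \<chi> i. force A X c i z)"
      by (simp add: vec_eq_iff)
  qed
  show "X z = chart_vector (cotangent_atlas A) ?C z (0, \<chi> i. force A X c i z)"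
    if "z \<in> chart_dom ?C" for z
    using a[OF that] a_eq[OF that] by simp
  show "smooth_on (chart_map ?C ` chart_dom ?C) (\<lambda>y. (0::real^'n, \<chi> i. force A X c i (chart_inv ?C y)))"
    by (rule smooth_on_cong[OF cot.open_chart_range[OF C] smooth])
      (use a_eq[OF chart_inv_in_dom] in \<open>simp add: chart_map_chart_inv\<close>)
qed

end

section \<open>The evolution field of a Cartan mechanical system\<close>

locale cartan_system =
  fixes A :: "('m, real^'n) chart set" and K :: "'m cotangent \<Rightarrow> real"
    and Fe :: "'m cotangent \<Rightarrow> 'm cotangent tangent"
  assumes system: "cartan_mechanical_system A K Fe"

sublocale cartan_system \<subseteq> base_atlas A
  using system
  by unfold_locales (simp add: cartan_mechanical_system_def cartan_space_def smooth_manifold_def)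

context cartan_system
begin

abbreviation energy :: "'m cotangent \<Rightarrow> real" where
  "energy \<equiv> \<lambda>z. (K z)\<^sup>2"

lemma vertical_force: "vertical_vector_field A Fe"
  using system by (simp add: cartan_mechanical_system_def)

lemma smooth_energy:
  assumes "c \<in> A"
  shows "smooth_on (chart_map (induced_chart A c) ` (chart_dom (induced_chart A c) \<inter> slit_cotangent_bundle A))
    (\<lambda>y. energy (chart_inv (induced_chart A c) y))"
proof -
  have "smooth_on (chart_map (induced_chart A c) ` (chart_dom (induced_chart A c) \<inter> slit_cotangent_bundle A))
      (\<lambda>y. K (chart_inv (induced_chart A c) y))"
    using system induced_chart_in_cotangent_atlas[OF assms]
    unfolding cartan_mechanical_system_def cartan_space_def smooth_fun_on_def by blast
  then show ?thesis
    unfolding power2_eq_square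
    by (intro smooth_on_bounded_bilinear[OF bounded_bilinear_mult] open_slit_image assms)
qed

lemma smooth_near_energy: "z \<in> slit_cotangent_bundle A \<Longrightarrow> smooth_near (cotangent_atlas A) z energy"
  unfolding smooth_near_def
  by (rule exI[of _ "slit_cotangent_bundle A"])
    (use openin_slit smooth_energy in \<open>auto simp: smooth_fun_on_def cotangent_atlas_def\<close>)

text \<open>Both summands are known to be independent of the chart, although their sum was defined through one.\<close>

lemma local_evolution_vector_split:
  assumes "c \<in> A" "z \<in> chart_dom (induced_chart A c)" "z \<in> slit_cotangent_bundle A"
  shows "local_evolution_vector A K Fe c z f =
    1/2 * chart_vector (cotangent_atlas A) (induced_chart A c) z (hamiltonian_coords c energy z) f
    + 1/2 * Fe z f"
proof -
  have pd: "pd_x A c i energy z = vec_x A c i z energy" "pd_p A c i energy z = vec_p A c i z energy" for i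
    using smooth_near_energy[OF assms(3)]
    by (simp_all add: pd_x_def pd_p_def vec_x_def vec_p_def chart_vector_def)
  have "evolution_coords A K Fe c z =
      (1/2) *\<^sub>R hamiltonian_coords c energy z + (1/2) *\<^sub>R (0, \<chi> i. force A Fe c i z)"
    by (simp add: evolution_coords_def hamiltonian_coords_def pd prod_eq_iff vec_eq_iff)
  moreover note lin = cot.chart_vector_linear[OF induced_chart_in_cotangent_atlas[OF assms(1)] assms(2), of f]
  ultimately show ?thesis
    unfolding local_evolution_vector_eq[OF assms(1,2)]
      vertical_vector_field_in_chart(1)[OF vertical_force assms(1,2)]
    by (simp add: linear_add[OF lin] linear_cmul[OF lin] del: scaleR_Pair add_Pair)
qed

lemma local_evolution_vector_chart_independent:
  assumes "c \<in> A" "d \<in> A" "z \<in> slit_cotangent_bundle A" "fst z \<in> chart_dom c" "fst z \<in> chart_dom d"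
  shows "local_evolution_vector A K Fe c z = local_evolution_vector A K Fe d z"
proof -
  have z: "z \<in> chart_dom (induced_chart A c)" "z \<in> chart_dom (induced_chart A d)"
    using assms(3-5) by (auto simp: slit_cotangent_bundle_def in_induced_chart_dom)
  show ?thesis
    using local_evolution_vector_split[OF assms(1) z(1) assms(3)]
      local_evolution_vector_split[OF assms(2) z(2) assms(3)]
      hamiltonian_vector_chart_independent[OF assms(1,2) z]
    by auto
qed

lemma smooth_evolution_coords:
  assumes "c \<in> A"
  shows "smooth_on (chart_map (induced_chart A c) ` (chart_dom (induced_chart A c) \<inter> slit_cotangent_bundle A))
    (\<lambda>y. evolution_coords A K Fe c (chart_inv (induced_chart A c) y))"
proof -
  let ?C = "induced_chart A c"
  let ?S = "chart_map ?C ` (chart_dom ?C \<inter> slit_cotangent_bundle A)"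
  let ?dE = "\<lambda>y. frechet_derivative (\<lambda>y. energy (chart_inv ?C y)) (at y)"
  let ?F = "\<lambda>y. (0::real^'n, \<chi> i. force A Fe c i (chart_inv ?C y))"
  note o = open_slit_image[OF assms]
  have dE: "smooth_on ?S (\<lambda>y. ?dE y w)" for w
    by (rule smooth_on_frechet[OF smooth_energy[OF assms]])
  have F: "smooth_on ?S ?F"
    by (rule smooth_on_subset[OF vertical_vector_field_in_chart(2)[OF vertical_force assms]]) auto
  have "smooth_on ?S (\<lambda>y. (1/2) *\<^sub>R (\<chi> i. ?dE y (0, axis i 1), \<chi> i. - ?dE y (axis i 1, 0)) + (1/2) *\<^sub>R ?F y)"
    by (intro smooth_on_add smooth_on_bounded_linear[OF bounded_linear_scaleR_right] smooth_on_Pair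
        smooth_on_vec smooth_on_bounded_linear[OF bounded_linear_minus[OF bounded_linear_ident]] o dE F)
  then show ?thesis
  proof (rule smooth_on_cong[OF o])
    fix y assume "y \<in> ?S"
    then have "chart_map ?C (chart_inv ?C y) = y" by (auto simp: chart_map_chart_inv)
    then show "(1/2) *\<^sub>R (\<chi> i. ?dE y (0, axis i 1), \<chi> i. - ?dE y (axis i 1, 0)) + (1/2) *\<^sub>R ?F y
        = evolution_coords A K Fe c (chart_inv ?C y)"
      by (simp add: evolution_coords_def pd_x_def pd_p_def coord_deriv_def vec_eq_iff)
  qed
qed

definition evolution_field :: "'m cotangent \<Rightarrow> 'm cotangent tangent" where
  "evolution_field z = local_evolution_vector A K Fe (SOME c. c \<in> A \<and> fst z \<in> chart_dom c) z"

lemma slit_covered: "z \<in> slit_cotangent_bundle A \<Longrightarrow> \<exists>c. c \<in> A \<and> fst z \<in> chart_dom c"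
  by (auto simp: slit_cotangent_bundle_def cotangent_bundle_def manifold_carrier_def)

lemma evolution_field_eq:
  assumes "c \<in> A" "z \<in> slit_cotangent_bundle A" "fst z \<in> chart_dom c"
  shows "evolution_field z = local_evolution_vector A K Fe c z"
  unfolding evolution_field_def
  using someI_ex[OF slit_covered[OF assms(2)]] assms
  by (intro local_evolution_vector_chart_independent) auto

lemma evolution_field_in_chart:
  assumes "c \<in> A" "z \<in> slit_cotangent_bundle A" "fst z \<in> chart_dom c"
  shows "evolution_field z =
    chart_vector (cotangent_atlas A) (induced_chart A c) z (evolution_coords A K Fe c z)"
  unfolding evolution_field_eq[OF assms]
  using assms by (intro local_evolution_vector_eq) (auto simp: slit_cotangent_bundle_def in_induced_chart_dom)

lemma smooth_vector_field_evolution_field: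
  "smooth_vector_field (cotangent_atlas A) (slit_cotangent_bundle A) evolution_field"
  unfolding smooth_vector_field_def
proof (intro conjI ballI)
  fix z assume z: "z \<in> slit_cotangent_bundle A"
  then obtain c where c: "c \<in> A" "fst z \<in> chart_dom c" using slit_covered by blast
  with z have "z \<in> chart_dom (induced_chart A c)"
    by (simp add: slit_cotangent_bundle_def in_induced_chart_dom)
  then show "evolution_field z \<in> tangent_space (cotangent_atlas A) z"
    unfolding evolution_field_in_chart[OF c(1) z c(2)]
      cot.tangent_space_eq[OF induced_chart_in_cotangent_atlas[OF c(1)]]
    by (simp add: cot.tangent_space_eq[OF induced_chart_in_cotangent_atlas[OF c(1)]])
next
  fix C assume "C \<in> cotangent_atlas A"
  then obtain c where c: "c \<in> A" and C: "C = induced_chart A c" by (auto simp: cotangent_atlas_def)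
  show "\<exists>a. smooth_on (chart_map C ` (chart_dom C \<inter> slit_cotangent_bundle A)) a \<and>
    (\<forall>z\<in>chart_dom C \<inter> slit_cotangent_bundle A.
      evolution_field z = chart_vector (cotangent_atlas A) C z (a (chart_map C z)))"
  proof (intro exI conjI ballI)
    show "smooth_on (chart_map C ` (chart_dom C \<inter> slit_cotangent_bundle A))
        (\<lambda>y. evolution_coords A K Fe c (chart_inv C y))"
      unfolding C by (rule smooth_evolution_coords[OF c])
    fix z assume z: "z \<in> chart_dom C \<inter> slit_cotangent_bundle A"
    then have "fst z \<in> chart_dom c" by (auto simp: C chart_dom_induced_chart)
    with evolution_field_in_chart[OF c] z
    show "evolution_field z =
        chart_vector (cotangent_atlas A) C z (evolution_coords A K Fe c (chart_inv C (chart_map C z)))"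
      using \<open>C \<in> cotangent_atlas A\<close> by (simp add: C)
  qed
qed

lemma evolution_field_velocity_iff:
  assumes "c \<in> A" "open I" "t \<in> I" "\<gamma> t \<in> slit_cotangent_bundle A" "fst (\<gamma> t) \<in> chart_dom c"
    and "continuous_map (top_of_set I) (manifold_topology (cotangent_atlas A)) \<gamma>"
  shows "(\<forall>f. smooth_near (cotangent_atlas A) (\<gamma> t) f \<longrightarrow>
        ((\<lambda>s. f (\<gamma> s)) has_real_derivative evolution_field (\<gamma> t) f) (at t))
      \<longleftrightarrow> evolution_equations_at A K Fe c \<gamma> t"
proof -
  have "\<gamma> t \<in> chart_dom (induced_chart A c)"
    using assms(4,5) by (simp add: slit_cotangent_bundle_def in_induced_chart_dom)
  then show ?thesis
    unfolding evolution_equations_at_iff evolution_field_in_chart[OF assms(1,4,5)]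
    by (rule cot.velocity_in_chart[OF induced_chart_in_cotangent_atlas[OF assms(1)] assms(2,3) _ assms(6)])
qed

lemma integral_curve_iff_evolution_equations:
  assumes "open I" and \<gamma>: "\<gamma> \<in> I \<rightarrow> slit_cotangent_bundle A"
  shows "integral_curve (cotangent_atlas A) (slit_cotangent_bundle A) evolution_field I \<gamma> \<longleftrightarrow>
    continuous_map (top_of_set I) (manifold_topology (cotangent_atlas A)) \<gamma> \<and>
    (\<forall>c\<in>A. \<forall>t\<in>I. fst (\<gamma> t) \<in> chart_dom c \<longrightarrow> evolution_equations_at A K Fe c \<gamma> t)"
    (is "?integral \<longleftrightarrow> ?cont \<and> ?eqs")
proof (cases ?cont)
  case True
  let ?vel = "\<lambda>t. \<forall>f. smooth_near (cotangent_atlas A) (\<gamma> t) f \<longrightarrow>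
        ((\<lambda>s. f (\<gamma> s)) has_real_derivative evolution_field (\<gamma> t) f) (at t)"
  have vel: "?vel t \<longleftrightarrow> evolution_equations_at A K Fe c \<gamma> t"
    if "t \<in> I" "c \<in> A" "fst (\<gamma> t) \<in> chart_dom c" for c t
    using \<gamma> that by (intro evolution_field_velocity_iff[OF _ assms(1) _ _ _ True]) auto
  have cover: "\<exists>c. c \<in> A \<and> fst (\<gamma> t) \<in> chart_dom c" if "t \<in> I" for t
    using slit_covered \<gamma> that by blast
  have "(\<forall>t\<in>I. ?vel t) \<longleftrightarrow> ?eqs"
    using vel cover by meson
  then show ?thesis
    unfolding integral_curve_def using True \<gamma> by simp
qed (simp add: integral_curve_def)

text \<open>The evolution equations make the coordinates of the curve differentiable, hence continuous, and a curve
  inside one chart inherits continuity from its coordinates.\<close>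

lemma integral_curve_iff_evolution_equations_in_chart:
  assumes "open I" and \<gamma>: "\<gamma> \<in> I \<rightarrow> slit_cotangent_bundle A"
    and c: "c \<in> A" "\<forall>t\<in>I. fst (\<gamma> t) \<in> chart_dom c"
  shows "integral_curve (cotangent_atlas A) (slit_cotangent_bundle A) evolution_field I \<gamma> \<longleftrightarrow>
    (\<forall>t\<in>I. evolution_equations_at A K Fe c \<gamma> t)"
proof
  assume "integral_curve (cotangent_atlas A) (slit_cotangent_bundle A) evolution_field I \<gamma>"
  then show "\<forall>t\<in>I. evolution_equations_at A K Fe c \<gamma> t"
    using c unfolding integral_curve_iff_evolution_equations[OF assms(1,2)] by blast
next
  assume eqs: "\<forall>t\<in>I. evolution_equations_at A K Fe c \<gamma> t"
  have dom: "\<gamma> \<in> I \<rightarrow> chart_dom (induced_chart A c)"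
  proof
    fix t assume "t \<in> I"
    then have "\<gamma> t \<in> cotangent_bundle A" "fst (\<gamma> t) \<in> chart_dom c"
      using \<gamma> c(2) by (auto simp: slit_cotangent_bundle_def)
    then show "\<gamma> t \<in> chart_dom (induced_chart A c)" by (simp add: in_induced_chart_dom)
  qed
  have "isCont (\<lambda>s. chart_map (induced_chart A c) (\<gamma> s)) t" if "t \<in> I" for t
    using eqs that unfolding evolution_equations_at_iff by (blast intro: has_vector_derivative_continuous)
  then have "continuous_on I (\<lambda>s. chart_map (induced_chart A c) (\<gamma> s))"
    by (simp add: continuous_at_imp_continuous_on)
  then have cont: "continuous_map (top_of_set I) (manifold_topology (cotangent_atlas A)) \<gamma>"
    by (rule cot.continuous_map_if_continuous_in_chart[OF induced_chart_in_cotangent_atlas[OF c(1)] dom])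
  have "\<forall>f. smooth_near (cotangent_atlas A) (\<gamma> t) f \<longrightarrow>
        ((\<lambda>s. f (\<gamma> s)) has_real_derivative evolution_field (\<gamma> t) f) (at t)" if t: "t \<in> I" for t
  proof -
    have "\<gamma> t \<in> slit_cotangent_bundle A" "fst (\<gamma> t) \<in> chart_dom c" using \<gamma> c(2) t by auto
    from evolution_field_velocity_iff[OF c(1) assms(1) t this cont] show ?thesis
      using eqs t by blast
  qed
  then show "integral_curve (cotangent_atlas A) (slit_cotangent_bundle A) evolution_field I \<gamma>"
    unfolding integral_curve_def using \<gamma> cont by blast
qed

end

theorem theorem4p4p1:
  fixes A :: "('m, real^'n) chart set"
    and K :: "'m cotangent \<Rightarrow> real"
    and Fe :: "'m cotangent \<Rightarrow> 'm cotangent tangent"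
  assumes "cartan_mechanical_system A K Fe"
  shows "\<exists>\<xi>.
    (smooth_vector_field (cotangent_atlas A) (slit_cotangent_bundle A) \<xi> \<and>
     (\<forall>c\<in>A. \<forall>z\<in>slit_cotangent_bundle A. fst z \<in> chart_dom c \<longrightarrow>
        \<xi> z = local_evolution_vector A K Fe c z)) \<and>
    (\<forall>\<eta>. (\<forall>z\<in>slit_cotangent_bundle A. \<exists>c\<in>A. fst z \<in> chart_dom c \<and>
            \<eta> z = local_evolution_vector A K Fe c z) \<longrightarrow>
         (\<forall>z\<in>slit_cotangent_bundle A. \<eta> z = \<xi> z)) \<and>
    (\<forall>I \<gamma>. open I \<and> is_interval I \<and> \<gamma> \<in> I \<rightarrow> slit_cotangent_bundle A \<longrightarrow>
       (integral_curve (cotangent_atlas A) (slit_cotangent_bundle A) \<xi> I \<gamma> \<longleftrightarrow>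
          continuous_map (top_of_set I) (manifold_topology (cotangent_atlas A)) \<gamma> \<and>
          (\<forall>c\<in>A. \<forall>t\<in>I. fst (\<gamma> t) \<in> chart_dom c \<longrightarrow> evolution_equations_at A K Fe c \<gamma> t)) \<and>
       (\<forall>c\<in>A. (\<forall>t\<in>I. fst (\<gamma> t) \<in> chart_dom c) \<longrightarrow>
          (integral_curve (cotangent_atlas A) (slit_cotangent_bundle A) \<xi> I \<gamma> \<longleftrightarrow>
             (\<forall>t\<in>I. evolution_equations_at A K Fe c \<gamma> t))))"
proof -
  interpret cartan_system A K Fe
    by unfold_locales (rule assms)
  show ?thesis
  proof (rule exI[of _ evolution_field], intro conjI allI impI ballI; (elim conjE)?)
    show "smooth_vector_field (cotangent_atlas A) (slit_cotangent_bundle A) evolution_field"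
      by (rule smooth_vector_field_evolution_field)
  next
    fix c z
    assume "c \<in> A" "z \<in> slit_cotangent_bundle A" "fst z \<in> chart_dom c"
    then show "evolution_field z = local_evolution_vector A K Fe c z"
      by (rule evolution_field_eq)
  next
    fix \<eta> z
    assume "\<forall>z\<in>slit_cotangent_bundle A. \<exists>c\<in>A. fst z \<in> chart_dom c \<and>
        \<eta> z = local_evolution_vector A K Fe c z"
      and "z \<in> slit_cotangent_bundle A"
    then show "\<eta> z = evolution_field z"
      using evolution_field_eq by metis
  next
    fix I :: "real set" and \<gamma> :: "real \<Rightarrow> 'm cotangent"
    assume "open I" "\<gamma> \<in> I \<rightarrow> slit_cotangent_bundle A"
    then show "integral_curve (cotangent_atlas A) (slit_cotangent_bundle A) evolution_field I \<gamma> \<longleftrightarrow>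
        continuous_map (top_of_set I) (manifold_topology (cotangent_atlas A)) \<gamma> \<and>
        (\<forall>c\<in>A. \<forall>t\<in>I. fst (\<gamma> t) \<in> chart_dom c \<longrightarrow> evolution_equations_at A K Fe c \<gamma> t)"
      by (rule integral_curve_iff_evolution_equations)
  next
    fix I :: "real set" and \<gamma> :: "real \<Rightarrow> 'm cotangent" and c
    assume "open I" "\<gamma> \<in> I \<rightarrow> slit_cotangent_bundle A" "c \<in> A" "\<forall>t\<in>I. fst (\<gamma> t) \<in> chart_dom c"
    then show "integral_curve (cotangent_atlas A) (slit_cotangent_bundle A) evolution_field I \<gamma> \<longleftrightarrow>
        (\<forall>t\<in>I. evolution_equations_at A K Fe c \<gamma> t)"
      by (rule integral_curve_iff_evolution_equations_in_chart)
  qed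
qed

end
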